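(* The j-invariant of the Spohn cubic of a $2\times 2$ game with payoff matrices $(a_{ij})$, $(b_{ij})$ equals $\mathcal{I}(a,b)^3/\mathcal{D}(a,b)$, where $\mathcal{D}(a,b)$ is the discriminant of the Spohn cubic and $\mathcal{I}(a,b)$ is an irreducible polynomial of degree $8$ with $633$ terms in the entries $a_{11},a_{12},a_{21},a_{22},b_{11},b_{12},b_{21},b_{22}$ of the two payoff tables.
   Context: For payoff matrices $(a_{ij})$ and $(b_{ij})$ of format $2\times2$, the Spohn cubic is the ternary cubic in $x,y,z$ $$c_1x^2y+c_2x^2z+c_3xy^2+c_4xz^2+c_5y^2z+c_6yz^2+c_7xyz$$ with coefficients $$\begin{aligned}c_1&=(a_{11}-a_{22})(b_{11}-b_{12}),& c_2&=(a_{11}-a_{21})(b_{22}-b_{11}),& c_3&=(a_{12}-a_{22})(b_{11}-b_{12}),\\ c_4&=(a_{11}-a_{21})(b_{22}-b_{21}),& c_5&=(a_{12}-a_{22})(b_{21}-b_{12}),& c_6&=(a_{12}-a_{21})(b_{22}-b_{21}),\\ c_7&=(a_{12}-a_{21})(b_{22}-b_{11})+(a_{11}-a_{22})(b_{21}-b_{12}).\end{aligned}$$ It is a plane model of the Spohn curve of the game, and it is a smooth plane cubic for generic $a_{ij},b_{ij}$. The discriminant $\mathcal{D}$ of a ternary cubic of the form $c_1x^2y+c_2x^2z+c_3xy^2+c_4xz^2+c_5y^2z+c_6yz^2+c_7xyz$, with $c_1,\dots,c_7$ unknowns, is the irreducible primitive integer polynomial of degree $12$ in $c_1,\dots,c_7$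 (with $127$ terms) that vanishes exactly when the cubic curve in $\mathbb{P}^2$ is singular; it reads $\mathcal{D}=16c_1^5c_4^2c_5^2c_6^3+16c_1^4c_2^2c_5^2c_6^4-24c_1^4c_2c_4^2c_5^3c_6^2+\cdots+c_2^2c_3^2c_4^2c_5^2c_7^4-c_2^2c_3^2c_4c_5c_6c_7^5$. The polynomial $\mathcal{D}(a,b)$, of degree $24$ in the eight unknowns $a_{ij},b_{ij}$, is obtained from $\mathcal{D}$ by substituting $c_1=(a_{11}-a_{22})(b_{11}-b_{12})$, $c_2=(a_{11}-a_{21})(b_{22}-b_{11})$, $c_3=(a_{12}-a_{22})(b_{11}-b_{12})$, $c_4=(a_{11}-a_{21})(b_{22}-b_{21})$, $c_5=(a_{12}-a_{22})(b_{21}-b_{12})$, $c_6=(a_{12}-a_{21})(b_{22}-b_{21})$, $c_7=(a_{12}-a_{21})(b_{22}-b_{11})+(a_{11}-a_{22})(b_{21}-b_{12})$. The j-invariant is the usual j-invariant of a smooth plane cubic (for which $y^2=x^3-x$ has j-invariant $1728$), and the formula is an identity wherever $\mathcal{D}(a,b)\neq0$. *)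

theory Defs
  imports "HOL-Analysis.Analysis" "HOL-Library.Poly_Mapping"
    "HOL-Computational_Algebra.Factorial_Ring"
begin

section \<open>Multivariate polynomials\<close>

text \<open>The type \<open>('v, 'a) mpol\<close> is the polynomial ring over \<open>'a\<close> with one indeterminate for
  each element of \<open>'v\<close>. Multiplication is the convolution product of
  \<^theory>\<open>HOL-Library.Poly_Mapping\<close>; \<open>keys p\<close> is the set of exponent vectors of the terms of \<open>p\<close>.\<close>

type_synonym ('v, 'a) mpol = "('v \<Rightarrow>\<^sub>0 nat) \<Rightarrow>\<^sub>0 'a"

definition Const :: "'a::zero \<Rightarrow> ('v, 'a) mpol" where
  "Const c = Poly_Mapping.single 0 c"

definition Var :: "'v \<Rightarrow> ('v, 'a::zero_neq_one) mpol" where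
  "Var v = Poly_Mapping.single (Poly_Mapping.single v 1) 1"

definition num_terms :: "('v, 'a::zero) mpol \<Rightarrow> nat" where
  "num_terms p = card (Poly_Mapping.keys p)"

definition total_degree :: "('v, 'a::zero) mpol \<Rightarrow> nat" where
  "total_degree p =
     Max (insert 0 ((\<lambda>m. \<Sum>v\<in>Poly_Mapping.keys m. Poly_Mapping.lookup m v) ` Poly_Mapping.keys p))"

text \<open>Evaluation: coefficients are mapped along \<open>h\<close>, the indeterminate \<open>v\<close> is replaced by \<open>\<sigma> v\<close>.\<close>

definition peval :: "('a::zero \<Rightarrow> 'b::comm_semiring_1) \<Rightarrow> ('v \<Rightarrow> 'b) \<Rightarrow> ('v, 'a) mpol \<Rightarrow> 'b" where
  "peval h \<sigma> p =
     (\<Sum>m\<in>Poly_Mapping.keys p. h (Poly_Mapping.lookup p m) *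
        (\<Prod>v\<in>Poly_Mapping.keys m. \<sigma> v ^ Poly_Mapping.lookup m v))"

definition partial_deriv :: "'v \<Rightarrow> ('v, 'a::comm_semiring_1) mpol \<Rightarrow> ('v, 'a) mpol" where
  "partial_deriv v p =
     (\<Sum>m\<in>Poly_Mapping.keys p.
        Poly_Mapping.single (m - Poly_Mapping.single v 1)
          (of_nat (Poly_Mapping.lookup m v) * Poly_Mapping.lookup p m))"


section \<open>Plane curves and the j-invariant\<close>

text \<open>Homogeneous coordinates of the projective plane are indexed by the type \<open>3\<close>, with
  \<open>x, y, z\<close> the coordinates \<open>1, 2, 3\<close>.\<close>

definition singular_curve :: "(3, complex) mpol \<Rightarrow> bool" where
  "singular_curve F \<longleftrightarrow>
     (\<exists>P :: complex^3. P \<noteq> 0 \<and> peval id (($) P) F = 0 \<and>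
        (\<forall>i. peval id (($) P) (partial_deriv i F) = 0))"

definition linear_subst :: "complex^3^3 \<Rightarrow> (3, complex) mpol \<Rightarrow> (3, complex) mpol" where
  "linear_subst M F = peval Const (\<lambda>i. \<Sum>j\<in>UNIV. Const (M $ i $ j) * Var j) F"

definition projectively_equivalent :: "(3, complex) mpol \<Rightarrow> (3, complex) mpol \<Rightarrow> bool" where
  "projectively_equivalent F G \<longleftrightarrow>
     (\<exists>(M :: complex^3^3) k. invertible M \<and> k \<noteq> 0 \<and> linear_subst M F = Const k * G)"

definition weierstrass_cubic :: "complex \<Rightarrow> complex \<Rightarrow> (3, complex) mpol" where
  "weierstrass_cubic A B =
     Var 2 ^ 2 * Var 3 - Var 1 ^ 3 - Const A * Var 1 * Var 3 ^ 2 - Const B * Var 3 ^ 3"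

text \<open>Every smooth plane cubic over the complex numbers is projectively equivalent to some
  \<open>y\<^sup>2 = x\<^sup>3 + A x + B\<close> with \<open>4 A\<^sup>3 + 27 B\<^sup>2 \<noteq> 0\<close>, and the value below does not depend on the
  choice of \<open>A\<close> and \<open>B\<close>. The normalisation gives 1728 for \<open>y\<^sup>2 = x\<^sup>3 - x\<close>.\<close>

definition j_invariant :: "(3, complex) mpol \<Rightarrow> complex" where
  "j_invariant F =
     (THE j. \<exists>A B. 4 * A ^ 3 + 27 * B ^ 2 \<noteq> 0 \<and>
        projectively_equivalent F (weierstrass_cubic A B) \<and>
        j = 1728 * (4 * A ^ 3) / (4 * A ^ 3 + 27 * B ^ 2))"


section \<open>Cubics through the coordinate points and their discriminant\<close>

datatype cubic_coeff = C1 | C2 | C3 | C4 | C5 | C6 | C7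

definition cubic_of_coeffs :: "(cubic_coeff \<Rightarrow> complex) \<Rightarrow> (3, complex) mpol" where
  "cubic_of_coeffs c =
     (let x = Var 1; y = Var 2; z = Var 3 in
       Const (c C1) * x^2 * y + Const (c C2) * x^2 * z + Const (c C3) * x * y^2 +
       Const (c C4) * x * z^2 + Const (c C5) * y^2 * z + Const (c C6) * y * z^2 +
       Const (c C7) * x * y * z)"

text \<open>The conditions determine \<open>D\<close> uniquely: by the Nullstellensatz, irreducibility and the zero
  set determine \<open>D\<close> up to sign, and the coefficient of \<open>c\<^sub>1\<^sup>5 c\<^sub>4\<^sup>2 c\<^sub>5\<^sup>2 c\<^sub>6\<^sup>3\<close> fixes the sign.
  The zero polynomial \<open>c = 0\<close> counts as singular.\<close>

definition is_cubic_discriminant :: "(cubic_coeff, int) mpol \<Rightarrow> bool" where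
  "is_cubic_discriminant D \<longleftrightarrow>
     irreducible D \<and>
     (\<forall>k. (\<forall>m. k dvd Poly_Mapping.lookup D m) \<longrightarrow> is_unit k) \<and>
     total_degree D = 12 \<and>
     num_terms D = 127 \<and>
     (\<forall>c :: cubic_coeff \<Rightarrow> complex.
        peval of_int c D = 0 \<longleftrightarrow> singular_curve (cubic_of_coeffs c)) \<and>
     Poly_Mapping.lookup D
       (Poly_Mapping.single C1 5 + Poly_Mapping.single C4 2 +
        Poly_Mapping.single C5 2 + Poly_Mapping.single C6 3) = 16"


section \<open>The Spohn cubic\<close>

fun spohn_coeff :: "complex^2^2 \<Rightarrow> complex^2^2 \<Rightarrow> cubic_coeff \<Rightarrow> complex" where
  "spohn_coeff a b C1 = (a$1$1 - a$2$2) * (b$1$1 - b$1$2)"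
| "spohn_coeff a b C2 = (a$1$1 - a$2$1) * (b$2$2 - b$1$1)"
| "spohn_coeff a b C3 = (a$1$2 - a$2$2) * (b$1$1 - b$1$2)"
| "spohn_coeff a b C4 = (a$1$1 - a$2$1) * (b$2$2 - b$2$1)"
| "spohn_coeff a b C5 = (a$1$2 - a$2$2) * (b$2$1 - b$1$2)"
| "spohn_coeff a b C6 = (a$1$2 - a$2$1) * (b$2$2 - b$2$1)"
| "spohn_coeff a b C7 =
     (a$1$2 - a$2$1) * (b$2$2 - b$1$1) + (a$1$1 - a$2$2) * (b$2$1 - b$1$2)"

definition spohn_cubic :: "complex^2^2 \<Rightarrow> complex^2^2 \<Rightarrow> (3, complex) mpol" where
  "spohn_cubic a b = cubic_of_coeffs (spohn_coeff a b)"

text \<open>The eight unknowns \<open>a\<^sub>i\<^sub>j\<close>, \<open>b\<^sub>i\<^sub>j\<close>; the type \<open>2\<close> has exactly the elements \<open>1\<close> and \<open>2\<close>.\<close>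

datatype payoff_var = PayA 2 2 | PayB 2 2

fun payoff_entry :: "complex^2^2 \<Rightarrow> complex^2^2 \<Rightarrow> payoff_var \<Rightarrow> complex" where
  "payoff_entry a b (PayA i j) = a $ i $ j"
| "payoff_entry a b (PayB i j) = b $ i $ j"

end

theory Submission
  imports Defs "HOL-Computational_Algebra.Fundamental_Theorem_Algebra"
begin

text \<open>The cubic is quadratic in \<open>x\<close>, say \<open>A x\<^sup>2 + B x + C\<close> with forms \<open>A\<close>, \<open>B\<close>, \<open>C\<close> in \<open>y\<close>, \<open>z\<close> of degrees
1, 2, 3. Projection from the point \<open>(1:0:0)\<close> presents it as a double cover of the line, branched over
the zeros of the binary quartic \<open>B\<^sup>2 - 4 A C\<close>. The invariants of this quartic are those of the
Jacobian elliptic curve of the cubic, and Tate's formulas for the latter give polynomials with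
integer coefficients: \<open>c4_form\<close>, of degree 4 in the coefficients of the cubic, and
\<open>discriminant_form\<close>, of degree 12. The witnesses are \<open>cubic_discriminant\<close>, which is
\<open>discriminant_form\<close> in the indeterminates, and \<open>spohn_invariant\<close>, which is \<open>c4_form\<close> after the
substitution of the payoff entries.

The zero set. The Aronhold invariants \<open>S\<close> and \<open>T\<close> of ternary cubics take the values \<open>c\<^sub>4\<close> and
\<open>- c\<^sub>6\<close> of the Jacobian here, and \<open>S\<^sup>3 - T\<^sup>2\<close> is 1728 times the discriminant. They are multiplied by powers of the
determinant under linear substitutions (\<open>covariant_if_det_nonzero\<close>), so a singular point can be
moved to \<open>(0:0:1)\<close>, where \<open>S\<^sup>3 = T\<^sup>2\<close> is evident (\<open>singular_imp_invariants\<close>). Conversely, if the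
discriminant vanishes, then the quartic has a repeated root, and above it lies a singular point
(\<open>singular_if_discriminant_zero\<close>).

The j-invariant. It comes out as \<open>1728 S\<^sup>3 / (S\<^sup>3 - T\<^sup>2)\<close> from every Weierstrass cubic that is projectively
equivalent to the given one (\<open>j_if_equivalent\<close>); this settles uniqueness. Existence
needs a flex (\<open>weierstrass_if_zero_at_x\<close>): unless the point \<open>(1:0:0)\<close> is one itself, a change of
coordinates that keeps this point leaves a cubic with three parameters, for which \<open>x\<close> can be eliminated by hand from the
equations of the cubic and of its Hessian; what remains is a univariate polynomial, which has a root.

Irreducibility. A polynomial that is homogeneous of degree \<open>d\<close> is irreducible over the integers as
soon as its restriction to one line \<open>t \<mapsto> \<alpha> + t \<beta>\<close> has degree \<open>d\<close> and a prime constant term that exceeds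
the sum of the absolute values of the other coefficients (\<open>irreducible_by_line\<close>): such a polynomial
in \<open>t\<close> has no zero in the closed unit disc, whereas a nonconstant factor with constant term \<open>\<plusminus>1\<close> would
have one. One line for each of the two polynomials suffices.

The numbers of terms are found by expansion. The substitution of \<open>x^(16^i)\<close> for the \<open>i\<close>-th
indeterminate keeps all monomials apart, so that the expansion can be done with lists of pairs of
integers (\<open>num_terms_if_nested_check\<close>).\<close>

section \<open>Evaluation as a ring homomorphism\<close>

definition monom_val :: "('v \<Rightarrow> 'b::comm_semiring_1) \<Rightarrow> ('v \<Rightarrow>\<^sub>0 nat) \<Rightarrow> 'b" where
  "monom_val \<sigma> m = (\<Prod>v\<in>Poly_Mapping.keys m. \<sigma> v ^ Poly_Mapping.lookup m v)"

lemma monom_val_superset: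
  assumes "finite A" "Poly_Mapping.keys m \<subseteq> A"
  shows "monom_val \<sigma> m = (\<Prod>v\<in>A. \<sigma> v ^ Poly_Mapping.lookup m v)"
  unfolding monom_val_def
  by (rule prod.mono_neutral_left) (use assms in \<open>auto simp: in_keys_iff\<close>)

lemma monom_val_add: "monom_val \<sigma> (m + n) = monom_val \<sigma> m * monom_val \<sigma> n"
proof -
  let ?A = "Poly_Mapping.keys m \<union> Poly_Mapping.keys n"
  have "monom_val \<sigma> (m + n) = (\<Prod>v\<in>?A. \<sigma> v ^ Poly_Mapping.lookup (m + n) v)"
    by (rule monom_val_superset) (use Poly_Mapping.keys_add[of m n] in auto)
  also have "\<dots> = monom_val \<sigma> m * monom_val \<sigma> n"
    by (simp add: lookup_add power_add prod.distrib monom_val_superset[of ?A])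
  finally show ?thesis .
qed

lemma monom_val_0 [simp]: "monom_val \<sigma> 0 = 1"
  by (simp add: monom_val_def)

lemma monom_val_single [simp]: "monom_val \<sigma> (Poly_Mapping.single v n) = \<sigma> v ^ n"
  by (cases "n = 0") (auto simp: monom_val_def)

lemma poly_mapping_single_add_induct [case_names zero single_add]:
  fixes p :: "'k \<Rightarrow>\<^sub>0 'a::comm_monoid_add"
  assumes "P 0"
    and "\<And>k c q. P q \<Longrightarrow> P (Poly_Mapping.single k c + q)"
  shows "P p"
proof (induction p rule: update_induct)
  case const
  then show ?case by (fact assms(1))
next
  case (update f a b)
  have "Poly_Mapping.update a b f = Poly_Mapping.single a b + f"
    using update(1)
    by (intro poly_mapping_eqI) (auto simp: lookup_update lookup_add lookup_single in_keys_iff when_def)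
  then show ?case using assms(2)[OF update(3)] by simp
qed

text \<open>Evaluation respects products only if the coefficients are mapped by a ring homomorphism. Three of
them occur below: the integers go to an arbitrary ring, the complex numbers to themselves, and the
constants into a polynomial ring, which makes evaluation the substitution of polynomials.\<close>

locale coeff_hom =
  fixes h :: "'a::comm_ring_1 \<Rightarrow> 'b::comm_ring_1"
  assumes h_add: "h (x + y) = h x + h y"
    and h_mult: "h (x * y) = h x * h y"
    and h_1: "h 1 = 1"
begin

lemma h_0 [simp]: "h 0 = 0"
  using h_add[of 0 0] by simp

lemma peval_superset:
  assumes "finite A" "Poly_Mapping.keys p \<subseteq> A"
  shows "peval h \<sigma> p = (\<Sum>m\<in>A. h (Poly_Mapping.lookup p m) * monom_val \<sigma> m)"
  unfolding peval_def monom_val_def[symmetric]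
  by (rule sum.mono_neutral_left) (use assms in \<open>auto simp: in_keys_iff\<close>)

lemma peval_single: "peval h \<sigma> (Poly_Mapping.single m c) = h c * monom_val \<sigma> m"
  by (subst peval_superset[of "{m}"]) auto

lemma peval_0 [simp]: "peval h \<sigma> 0 = 0"
  by (simp add: peval_def)

lemma peval_add: "peval h \<sigma> (p + q) = peval h \<sigma> p + peval h \<sigma> q"
proof -
  let ?A = "Poly_Mapping.keys p \<union> Poly_Mapping.keys q"
  have "peval h \<sigma> (p + q) = (\<Sum>m\<in>?A. h (Poly_Mapping.lookup (p + q) m) * monom_val \<sigma> m)"
    by (rule peval_superset) (use Poly_Mapping.keys_add[of p q] in auto)
  also have "\<dots> = peval h \<sigma> p + peval h \<sigma> q"
    by (simp add: peval_superset[of ?A] lookup_add h_add ring_distribs sum.distrib)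
  finally show ?thesis .
qed

lemma peval_mult: "peval h \<sigma> (p * q) = peval h \<sigma> p * peval h \<sigma> q"
proof (induction p rule: poly_mapping_single_add_induct)
  case zero
  then show ?case by simp
next
  case (single_add k c p)
  have "peval h \<sigma> (Poly_Mapping.single k c * q) = h c * monom_val \<sigma> k * peval h \<sigma> q"
  proof (induction q rule: poly_mapping_single_add_induct)
    case zero
    then show ?case by simp
  next
    case (single_add l d q)
    then show ?case
      by (simp add: ring_distribs peval_add mult_single peval_single monom_val_add h_mult mult_ac)
  qed
  with single_add show ?case
    by (simp add: ring_distribs peval_add peval_single)
qed

lemma peval_uminus: "peval h \<sigma> (- p) = - peval h \<sigma> p"
  using peval_add[of \<sigma> p "- p"] by (simp add: eq_neg_iff_add_eq_0 add.commute)

lemma peval_diff: "peval h \<sigma> (p - q) = peval h \<sigma> p - peval h \<sigma> q"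
  using peval_add[of \<sigma> p "- q"] by (simp add: peval_uminus)

lemma peval_Const [simp]: "peval h \<sigma> (Const c) = h c"
  by (simp add: Const_def peval_single)

lemma peval_1 [simp]: "peval h \<sigma> 1 = 1"
  using peval_Const[of \<sigma> 1] by (simp add: Const_def h_1)

lemma peval_Var [simp]: "peval h \<sigma> (Var v) = \<sigma> v"
  by (simp add: Var_def peval_single h_1)

lemma peval_power: "peval h \<sigma> (p ^ n) = peval h \<sigma> p ^ n"
  by (induction n) (simp_all add: peval_mult)

lemma peval_of_nat: "peval h \<sigma> (of_nat n) = of_nat n"
  by (induction n) (simp_all add: peval_add)

lemma peval_numeral: "peval h \<sigma> (numeral n) = numeral n"
  using peval_of_nat[of \<sigma> "numeral n"] by simp

lemma peval_sum: "peval h \<sigma> (\<Sum>i\<in>A. f i) = (\<Sum>i\<in>A. peval h \<sigma> (f i))"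
  by (induction A rule: infinite_finite_induct) (simp_all add: peval_add)

lemma peval_prod: "peval h \<sigma> (\<Prod>i\<in>A. f i) = (\<Prod>i\<in>A. peval h \<sigma> (f i))"
  by (induction A rule: infinite_finite_induct) (simp_all add: peval_mult)

lemmas peval_ring = peval_add peval_mult peval_uminus peval_diff peval_power peval_numeral

end

interpretation of_int_hom: coeff_hom "of_int :: int \<Rightarrow> 'b::comm_ring_1"
  by unfold_locales simp_all

interpretation id_hom: coeff_hom "id :: 'b::comm_ring_1 \<Rightarrow> 'b"
  by unfold_locales simp_all

interpretation Const_hom: coeff_hom "Const :: 'a::comm_ring_1 \<Rightarrow> ('v, 'a) mpol"
  by unfold_locales (simp_all add: Const_def single_add mult_single)

lemma (in coeff_hom) peval_peval_Const:
  "peval h \<sigma> (peval Const \<tau> p) = peval h (\<lambda>i. peval h \<sigma> (\<tau> i)) p"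
proof (induction p rule: poly_mapping_single_add_induct)
  case (single_add k c p)
  have "peval h \<sigma> (monom_val \<tau> k) = monom_val (\<lambda>i. peval h \<sigma> (\<tau> i)) k"
    by (simp add: monom_val_def peval_prod peval_power)
  with single_add show ?case
    by (simp add: Const_hom.peval_add peval_add Const_hom.peval_single peval_single peval_mult)
qed simp

text \<open>The exponent vector read as the digits of a number in base \<open>N\<close>, with the digit of \<open>v\<close> at position
\<open>idx v\<close>: the substitution of \<open>x^(N^idx v)\<close> for \<open>v\<close> turns the monomial with exponent vector \<open>m\<close> into
\<open>x^kronecker_code N idx m\<close>.\<close>

definition kronecker_code :: "nat \<Rightarrow> ('v \<Rightarrow> nat) \<Rightarrow> ('v \<Rightarrow>\<^sub>0 nat) \<Rightarrow> nat" where
  "kronecker_code N idx m = (\<Sum>v\<in>Poly_Mapping.keys m. N ^ idx v * Poly_Mapping.lookup m v)"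

lemma kronecker_code_UNIV:
  "kronecker_code N idx m = (\<Sum>v\<in>UNIV. N ^ idx v * Poly_Mapping.lookup m v)" for m :: "'v::finite \<Rightarrow>\<^sub>0 nat"
  unfolding kronecker_code_def by (rule sum.mono_neutral_left) (auto simp: in_keys_iff)

lemma digits_unique:
  fixes f g :: "nat \<Rightarrow> nat"
  assumes "\<And>i. f i < N" "\<And>i. g i < N"
    and "(\<Sum>i<n. N ^ i * f i) = (\<Sum>i<n. N ^ i * g i)" and "i < n"
  shows "f i = g i"
  using assms
proof (induction n arbitrary: f g i)
  case 0
  then show ?case by simp
next
  case (Suc n)
  have shift: "(\<Sum>i<Suc n. N ^ i * f i) = f 0 + N * (\<Sum>i<n. N ^ i * f (Suc i))" for f :: "nat \<Rightarrow> nat"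
    by (subst sum.lessThan_Suc_shift) (simp add: sum_distrib_left mult_ac)
  have eq: "f 0 + N * (\<Sum>i<n. N ^ i * f (Suc i)) = g 0 + N * (\<Sum>i<n. N ^ i * g (Suc i))"
    using Suc.prems(3) unfolding shift .
  have "(f 0 + N * (\<Sum>i<n. N ^ i * f (Suc i))) mod N = f 0"
       "(g 0 + N * (\<Sum>i<n. N ^ i * g (Suc i))) mod N = g 0"
    using Suc.prems(1)[of 0] Suc.prems(2)[of 0] by simp_all
  with eq have zero: "f 0 = g 0" by metis
  have "N > 0" using Suc.prems(1)[of 0] by simp
  with eq zero have "(\<Sum>i<n. N ^ i * f (Suc i)) = (\<Sum>i<n. N ^ i * g (Suc i))"
    by simp
  then have "f (Suc j) = g (Suc j)" if "j < n" for j
    using Suc.IH[of "\<lambda>i. f (Suc i)" "\<lambda>i. g (Suc i)" j] Suc.prems(1,2) that by auto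
  with zero Suc.prems(4) show ?case
    by (cases i) auto
qed

lemma kronecker_code_inj:
  fixes m m' :: "'v::finite \<Rightarrow>\<^sub>0 nat"
  assumes "inj idx"
    and "\<And>v. Poly_Mapping.lookup m v < N" "\<And>v. Poly_Mapping.lookup m' v < N"
    and "kronecker_code N idx m = kronecker_code N idx m'"
  shows "m = m'"
proof -
  define n where "n = Suc (Max (range idx))"
  have idx_less: "idx v < n" for v
    unfolding n_def by (simp add: less_Suc_eq_le)
  have code: "kronecker_code N idx k = (\<Sum>i<n. N ^ i * (if i \<in> range idx then Poly_Mapping.lookup k (the_inv idx i) else 0))"
    for k :: "'v \<Rightarrow>\<^sub>0 nat"
  proof -
    have "kronecker_code N idx k = (\<Sum>v\<in>UNIV. N ^ idx v * Poly_Mapping.lookup k v)"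
      by (rule kronecker_code_UNIV)
    also have "\<dots> = (\<Sum>i\<in>range idx. N ^ i * (if i \<in> range idx then Poly_Mapping.lookup k (the_inv idx i) else 0))"
      by (subst sum.reindex[OF assms(1)]) (simp add: the_inv_f_f[OF assms(1)])
    also have "\<dots> = (\<Sum>i<n. N ^ i * (if i \<in> range idx then Poly_Mapping.lookup k (the_inv idx i) else 0))"
      by (rule sum.mono_neutral_left) (use idx_less in auto)
    finally show ?thesis .
  qed
  have N: "0 < N" using assms(2)[of undefined] by simp
  have "Poly_Mapping.lookup m v = Poly_Mapping.lookup m' v" for v
    using digits_unique[OF _ _ assms(4)[unfolded code], of "idx v"] assms(2,3) N idx_less[of v]
    by (auto simp: the_inv_f_f[OF assms(1)] split: if_splits)
  then show ?thesis by (intro poly_mapping_eqI) auto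
qed

lemma monom_val_kronecker:
  "monom_val (\<lambda>v. x ^ (N ^ idx v)) m = x ^ kronecker_code N idx m"
  by (simp add: monom_val_def kronecker_code_def power_sum power_mult)

lemma exponents_bounded:
  fixes A :: "('v::finite \<Rightarrow>\<^sub>0 nat) set"
  assumes "finite A"
  obtains N where "\<And>m v. m \<in> A \<Longrightarrow> Poly_Mapping.lookup m v < N"
proof -
  let ?S = "(\<lambda>(m, v). Poly_Mapping.lookup m v) ` (A \<times> UNIV)"
  have "finite ?S" using assms by simp
  then have "Poly_Mapping.lookup m v < Suc (Max ?S)" if "m \<in> A" for m v
    using that by (intro le_imp_less_Suc Max_ge) auto
  then show ?thesis using that by blast
qed

lemma finite_type_inj_nat: "\<exists>idx :: 'v::finite \<Rightarrow> nat. inj idx"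
  using finite_imp_inj_to_nat_seg[of "UNIV :: 'v set"] by auto

text \<open>By Kronecker's substitution, distinct monomials become distinct powers of one indeterminate \<open>x\<close>.
The result is a univariate polynomial with the same coefficients, and it vanishes at every complex
number.\<close>

lemma mpol_zero_if_vanishes:
  fixes p :: "('v::finite, complex) mpol"
  assumes "\<And>\<sigma>. peval id \<sigma> p = 0"
  shows "p = 0"
proof -
  obtain N where N: "\<And>m v. m \<in> Poly_Mapping.keys p \<Longrightarrow> Poly_Mapping.lookup m v < N"
    using exponents_bounded[of "Poly_Mapping.keys p"] by auto
  obtain idx :: "'v \<Rightarrow> nat" where idx: "inj idx" using finite_type_inj_nat by blast
  let ?k = "kronecker_code N idx"
  define P where "P = (\<Sum>m\<in>Poly_Mapping.keys p. monom (Poly_Mapping.lookup p m) (?k m))"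
  have "poly P x = peval id (\<lambda>v. x ^ (N ^ idx v)) p" for x
    by (simp add: P_def poly_sum poly_monom id_hom.peval_superset[OF finite_keys order_refl]
        monom_val_kronecker)
  then have "P = 0" using assms poly_all_0_iff_0[of P] by simp
  have "Poly_Mapping.lookup p m = 0" if m: "m \<in> Poly_Mapping.keys p" for m
  proof -
    have "coeff P (?k m) = (\<Sum>m'\<in>Poly_Mapping.keys p. if m' = m then Poly_Mapping.lookup p m' else 0)"
      unfolding P_def coeff_sum
      by (intro sum.cong) (use kronecker_code_inj[OF idx N N] m in \<open>auto\<close>)
    with \<open>P = 0\<close> m show ?thesis by (simp add: in_keys_iff split: if_splits)
  qed
  then have "Poly_Mapping.keys p = {}" by (meson in_keys_iff all_not_in_conv)
  then show ?thesis by simp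
qed

text \<open>A projective equivalence is an equation of polynomials; this reduces it to an equation of values.\<close>

lemma mpol_eq_if_evals_eq:
  fixes p q :: "('v::finite, complex) mpol"
  assumes "\<And>\<sigma>. peval id \<sigma> p = peval id \<sigma> q"
  shows "p = q"
  using mpol_zero_if_vanishes[of "p - q"] assms by (simp add: id_hom.peval_diff)

section \<open>Total degree and homogeneity\<close>

definition monom_degree :: "('v \<Rightarrow>\<^sub>0 nat) \<Rightarrow> nat" where
  "monom_degree m = (\<Sum>v\<in>Poly_Mapping.keys m. Poly_Mapping.lookup m v)"

definition homogeneous :: "nat \<Rightarrow> ('v, 'a::zero) mpol \<Rightarrow> bool" where
  "homogeneous d p \<longleftrightarrow> (\<forall>m\<in>Poly_Mapping.keys p. monom_degree m = d)"

lemma monom_degree_add: "monom_degree (m + n) = monom_degree m + monom_degree n"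
proof -
  let ?A = "Poly_Mapping.keys m \<union> Poly_Mapping.keys n"
  have sup: "monom_degree k = (\<Sum>v\<in>?A. Poly_Mapping.lookup k v)" if "Poly_Mapping.keys k \<subseteq> ?A" for k
    unfolding monom_degree_def by (rule sum.mono_neutral_left) (use that in \<open>auto simp: in_keys_iff\<close>)
  show ?thesis
    using sup[of "m + n"] sup[of m] sup[of n] Poly_Mapping.keys_add[of m n]
    by (simp add: lookup_add sum.distrib)
qed

lemma monom_degree_single [simp]: "monom_degree (Poly_Mapping.single v n) = n"
  by (cases "n = 0") (auto simp: monom_degree_def)

lemma monom_degree_0_iff: "monom_degree m = 0 \<longleftrightarrow> m = 0"
  by (auto simp: monom_degree_def in_keys_iff intro: poly_mapping_eqI)

lemma lookup_le_monom_degree: "Poly_Mapping.lookup m v \<le> monom_degree m"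
proof (cases "v \<in> Poly_Mapping.keys m")
  case True
  then show ?thesis unfolding monom_degree_def by (intro member_le_sum) auto
qed (simp add: in_keys_iff)

lemma homogeneous_add: "homogeneous d p \<Longrightarrow> homogeneous d q \<Longrightarrow> homogeneous d (p + q)"
  using Poly_Mapping.keys_add[of p q] by (auto simp: homogeneous_def)

lemma homogeneous_uminus: "homogeneous d p \<Longrightarrow> homogeneous d (- p)" for p :: "('v, 'a::ab_group_add) mpol"
  by (simp add: homogeneous_def)

lemma homogeneous_diff: "homogeneous d p \<Longrightarrow> homogeneous d q \<Longrightarrow> homogeneous d (p - q)" for p :: "('v, 'a::ab_group_add) mpol"
  using homogeneous_add[of d p "- q"] homogeneous_uminus[of d q] by simp

lemma homogeneous_mult: "homogeneous d p \<Longrightarrow> homogeneous e q \<Longrightarrow> homogeneous (d + e) (p * q)"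
  for p q :: "('v, 'a::semiring_0) mpol"
  using Poly_Mapping.keys_mult[of p q] by (fastforce simp: homogeneous_def monom_degree_add)

lemma homogeneous_Var: "homogeneous 1 (Var v :: ('v, 'a::zero_neq_one) mpol)"
  by (simp add: homogeneous_def Var_def)

lemma homogeneous_numeral: "homogeneous 0 (numeral k :: ('v, 'a::comm_ring_1) mpol)"
  unfolding homogeneous_def monom_degree_0_iff single_numeral[symmetric]
  by (simp add: lookup_single when_def in_keys_iff del: single_numeral)

text \<open>The degrees of the two summands are compared by a premise of their own: backward application
then synthesises the degree of each summand, whatever the shape of that degree.\<close>

lemma homogeneous_add_eq:
  "homogeneous d p \<Longrightarrow> homogeneous e q \<Longrightarrow> e = d \<Longrightarrow> homogeneous d (p + q)"
  by (simp add: homogeneous_add)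

lemma homogeneous_diff_eq:
  "homogeneous d p \<Longrightarrow> homogeneous e q \<Longrightarrow> e = d \<Longrightarrow> homogeneous d (p - q)"
  for p q :: "('v, 'a::ab_group_add) mpol"
  by (simp add: homogeneous_diff)

lemmas homogeneous_intros = homogeneous_add_eq homogeneous_diff_eq homogeneous_uminus homogeneous_mult
  homogeneous_numeral homogeneous_Var

lemma exponent_less_if_homogeneous:
  "homogeneous d p \<Longrightarrow> m \<in> Poly_Mapping.keys p \<Longrightarrow> d < N \<Longrightarrow> Poly_Mapping.lookup m v < N"
  using lookup_le_monom_degree[of m v] by (auto simp: homogeneous_def)

lemma total_degree_homogeneous:
  assumes "homogeneous d p" "p \<noteq> 0"
  shows "total_degree p = d"
proof -
  have "monom_degree ` Poly_Mapping.keys p = {d}"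
    using assms by (auto simp: homogeneous_def) (metis ex_in_conv image_eqI keys_eq_empty)
  then show ?thesis
    unfolding total_degree_def monom_degree_def[symmetric] by simp
qed

section \<open>Irreducibility from the restriction to one line\<close>

text \<open>Up to sign, the product of all roots is the quotient of the constant and the leading
coefficient; were all roots outside the closed unit disc, it would have modulus greater than 1.\<close>

lemma poly_root_norm_le_1:
  fixes g :: "complex poly"
  assumes "degree g > 0" and "norm (coeff g 0) \<le> norm (lead_coeff g)"
  obtains z where "poly g z = 0" "norm z \<le> 1"
proof -
  have "g \<noteq> 0" using assms(1) by auto
  obtain A where "size A = degree g \<and> g = smult (lead_coeff g) (\<Prod>x\<in>#A. [:- x, 1:])"
    using alg_closed_imp_factorization[OF \<open>g \<noteq> 0\<close>] by (rule exE)
  note A = conjunct1[OF this] conjunct2[OF this]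
  have roots: "poly g z = 0" if "z \<in># A" for z
  proof -
    from multi_member_split[OF that] obtain B where "A = add_mset z B" by blast
    then have "poly (\<Prod>x\<in>#A. [:- x, 1:]) z = poly [:- z, 1:] z * poly (\<Prod>x\<in>#B. [:- x, 1:]) z"
      by (simp only: image_mset_add_mset prod_mset.add_mset poly_mult)
    then have "poly (\<Prod>x\<in>#A. [:- x, 1:]) z = 0" by simp
    then show ?thesis by (subst A(2)) (simp only: poly_smult mult_zero_right)
  qed
  have big: "norm (\<Prod>x\<in>#B. x) > 1" if "B \<noteq> {#}" "\<And>x. x \<in># B \<Longrightarrow> norm x > 1" for B :: "complex multiset"
    using that
  proof (induction B)
    case empty
    then show ?case by simp
  next
    case (add x B)
    have "norm x > 1" using add.prems by simp
    moreover have "norm (\<Prod>x\<in>#B. x) \<ge> 1"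
      using add by (cases "B = {#}") (auto intro: less_imp_le)
    ultimately show ?case
      by (simp add: norm_mult less_le_trans[OF _ mult_left_mono[of 1 _ "norm x"]])
  qed
  have "coeff g 0 = lead_coeff g * poly (\<Prod>x\<in>#A. [:- x, 1:]) 0"
    by (subst poly_0_coeff_0[symmetric], subst A(2)) simp
  moreover have "norm (poly (\<Prod>x\<in>#A. [:- x, 1:]) 0) = norm (\<Prod>x\<in>#A. x)"
    by (induction A) (simp_all add: norm_mult)
  ultimately have "norm (coeff g 0) = norm (lead_coeff g) * norm (\<Prod>x\<in>#A. x)"
    by (simp add: norm_mult)
  moreover have "norm (lead_coeff g) > 0" using \<open>g \<noteq> 0\<close> by simp
  ultimately have "\<not> norm (\<Prod>x\<in>#A. x) > 1"
    using assms(2) mult_strict_left_mono[of 1 "norm (\<Prod>x\<in>#A. x)" "norm (lead_coeff g)"] by linarith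
  moreover have "A \<noteq> {#}" using A(1) assms(1) by auto
  ultimately obtain z where z: "z \<in># A" "\<not> norm z > 1"
    using big[of A] by blast
  then show ?thesis using that[OF roots[OF z(1)]] by simp
qed

lemma map_poly_of_int_mult:
  "map_poly (of_int :: int \<Rightarrow> 'a::comm_ring_1) (p * q) = map_poly of_int p * map_poly of_int q"
  by (intro poly_eqI) (simp add: coeff_map_poly coeff_mult)

text \<open>The dominant constant term keeps all complex roots of the product outside the closed unit disc.
As it is prime, one factor has constant term 1 or -1. That factor is constant, since a nonzero
integer as leading coefficient has modulus at least 1 and would give it a root in the disc.\<close>

lemma dominant_prime_factor:
  fixes g h :: "int poly"
  assumes prime: "prime \<bar>coeff (g * h) 0\<bar>"
    and dominant: "(\<Sum>i=1..degree (g * h). \<bar>coeff (g * h) i\<bar>) < \<bar>coeff (g * h) 0\<bar>"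
  shows "degree g = 0 \<and> \<bar>coeff g 0\<bar> = 1 \<or> degree h = 0 \<and> \<bar>coeff h 0\<bar> = 1"
proof -
  have main: "degree g' = 0" if fact: "g * h = g' * h'" and unit: "\<bar>coeff g' 0\<bar> = 1" for g' h'
  proof (rule ccontr)
    assume deg: "degree g' \<noteq> 0"
    let ?G = "map_poly complex_of_int g'"
    have "norm (coeff ?G 0) \<le> norm (lead_coeff ?G)"
    proof -
      have "lead_coeff g' \<noteq> 0" using deg by auto
      then have "1 \<le> \<bar>lead_coeff g'\<bar>" by linarith
      then have "(1::real) \<le> of_int \<bar>lead_coeff g'\<bar>" by (simp only: of_int_1_le_iff)
      moreover have "of_int \<bar>coeff g' 0\<bar> = (1::real)" unfolding unit by simp
      ultimately show ?thesis by (simp add: coeff_map_poly degree_map_poly)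
    qed
    then obtain z where z: "poly ?G z = 0" "norm z \<le> 1"
      using poly_root_norm_le_1[of ?G] deg by (auto simp: degree_map_poly)
    let ?f = "g * h"
    have "poly (map_poly complex_of_int ?f) z = 0"
      using z(1) by (simp add: fact map_poly_of_int_mult)
    then have "0 = (\<Sum>i\<le>degree ?f. of_int (coeff ?f i) * z ^ i)"
      by (simp add: poly_altdef coeff_map_poly degree_map_poly)
    also have "\<dots> = of_int (coeff ?f 0) + (\<Sum>i=1..degree ?f. of_int (coeff ?f i) * z ^ i)"
      unfolding atMost_atLeast0 by (subst sum.atLeast_Suc_atMost) simp_all
    finally have "norm (complex_of_int (coeff ?f 0)) = norm (\<Sum>i=1..degree ?f. complex_of_int (coeff ?f i) * z ^ i)"
      by (metis add_eq_0_iff2 norm_minus_cancel)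
    also have "\<dots> \<le> (\<Sum>i=1..degree ?f. \<bar>real_of_int (coeff ?f i)\<bar>)"
      using z(2) by (intro sum_norm_le) (simp add: norm_mult norm_power mult_left_le power_le_one)
    finally show False using dominant
      by (simp flip: of_int_sum of_int_abs add: not_less)
  qed
  have "coeff (g * h) 0 = coeff g 0 * coeff h 0" by (simp add: coeff_mult)
  with prime have "\<bar>coeff g 0\<bar> = 1 \<or> \<bar>coeff h 0\<bar> = 1"
    using irreducibleD[OF prime_elem_imp_irreducible[OF prime_imp_prime_elem], of "\<bar>coeff (g * h) 0\<bar>" "\<bar>coeff g 0\<bar>" "\<bar>coeff h 0\<bar>"]
    by (auto simp: abs_mult)
  then show ?thesis using main[of g h] main[of h g] by (auto simp: mult.commute)
qed

text \<open>The substitution of \<open>s^(N^idx v) * t\<close> for \<open>v\<close>: the exponent of \<open>s\<close> records the exponent vector,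
the exponent of \<open>t\<close> the total degree. The target is an integral domain in which the degree in \<open>t\<close>
is additive, and this transports additivity to the total degree.\<close>

definition graded_kronecker :: "nat \<Rightarrow> ('v \<Rightarrow> nat) \<Rightarrow> ('v, int) mpol \<Rightarrow> int poly poly" where
  "graded_kronecker N idx = peval of_int (\<lambda>v. monom (monom 1 (N ^ idx v)) 1)"

lemma monom_val_graded_kronecker:
  "monom_val (\<lambda>v. monom (monom (1 :: int) (N ^ idx v)) 1) m = monom (monom 1 (kronecker_code N idx m)) (monom_degree m)"
proof -
  have "(\<Prod>v\<in>A. monom (monom (1 :: int) (N ^ idx v)) 1 ^ f v)
      = monom (monom 1 (\<Sum>v\<in>A. N ^ idx v * f v)) (\<Sum>v\<in>A. f v)" if "finite A" for A and f :: "'a \<Rightarrow> nat"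
    using that by (induction A) (simp_all add: monom_power mult_monom)
  then show ?thesis
    by (simp add: monom_val_def kronecker_code_def monom_degree_def)
qed

lemma graded_kronecker_sum:
  "graded_kronecker N idx p =
     (\<Sum>m\<in>Poly_Mapping.keys p. monom (monom (Poly_Mapping.lookup p m) (kronecker_code N idx m)) (monom_degree m))"
  unfolding graded_kronecker_def of_int_hom.peval_superset[OF finite_keys order_refl] monom_val_graded_kronecker
  by (simp add: of_int_monom mult_monom)

lemma coeff_graded_kronecker:
  fixes p :: "('v::finite, int) mpol"
  assumes idx: "inj idx" and N: "\<And>m v. m \<in> Poly_Mapping.keys p \<Longrightarrow> Poly_Mapping.lookup m v < N"
    and m: "m \<in> Poly_Mapping.keys p"
  shows "coeff (coeff (graded_kronecker N idx p) (monom_degree m)) (kronecker_code N idx m) = Poly_Mapping.lookup p m"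
proof -
  have "coeff (coeff (graded_kronecker N idx p) (monom_degree m)) (kronecker_code N idx m)
      = (\<Sum>m'\<in>Poly_Mapping.keys p. if m' = m then Poly_Mapping.lookup p m' else 0)"
    unfolding graded_kronecker_sum coeff_sum
    by (intro sum.cong) (use kronecker_code_inj[OF idx N N] m in \<open>auto\<close>)
  then show ?thesis using m by (simp add: in_keys_iff)
qed

lemma monom_degree_le_degree_graded_kronecker:
  fixes p :: "('v::finite, int) mpol"
  assumes "inj idx" "\<And>m v. m \<in> Poly_Mapping.keys p \<Longrightarrow> Poly_Mapping.lookup m v < N"
    and "m \<in> Poly_Mapping.keys p"
  shows "monom_degree m \<le> degree (graded_kronecker N idx p)"
  using coeff_graded_kronecker[OF assms] assms(3)
  by (intro le_degree) (auto simp: in_keys_iff)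

lemma graded_kronecker_nonzero:
  fixes p :: "('v::finite, int) mpol"
  assumes "inj idx" "\<And>m v. m \<in> Poly_Mapping.keys p \<Longrightarrow> Poly_Mapping.lookup m v < N"
    and "p \<noteq> 0"
  shows "graded_kronecker N idx p \<noteq> 0"
proof -
  obtain m where "m \<in> Poly_Mapping.keys p" using \<open>p \<noteq> 0\<close> by (metis all_not_in_conv keys_eq_empty)
  with coeff_graded_kronecker[OF assms(1,2) this] show ?thesis
    by (auto simp: in_keys_iff)
qed

lemma degree_graded_kronecker_homogeneous:
  "homogeneous d p \<Longrightarrow> degree (graded_kronecker N idx p) \<le> d"
  unfolding graded_kronecker_sum homogeneous_def
  by (intro degree_sum_le) (auto intro: order_trans[OF degree_monom_le])

lemma degree_monom_val_line:
  "degree (monom_val (\<lambda>v. [:\<alpha> v, \<beta> v:] :: int poly) m) \<le> monom_degree m"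
  unfolding monom_val_def monom_degree_def
  by (rule order_trans[OF degree_prod_sum_le])
     (auto intro!: sum_mono order_trans[OF degree_power_le])

text \<open>Restriction to a line does not raise degrees, and the total degrees of two factors add up to \<open>d\<close>.
Since the restriction of the product still has degree \<open>d\<close>, neither factor loses degree on the line.
A factor whose restriction is constant with value 1 or -1 is therefore that constant.\<close>

theorem irreducible_by_line:
  fixes p :: "('v::finite, int) mpol" and \<alpha> \<beta> :: "'v \<Rightarrow> int"
  defines "f \<equiv> peval of_int (\<lambda>v. [:\<alpha> v, \<beta> v:]) p"
  assumes hom: "homogeneous d p" and deg: "degree f = d"
    and prime: "prime \<bar>coeff f 0\<bar>"
    and dominant: "(\<Sum>i=1..d. \<bar>coeff f i\<bar>) < \<bar>coeff f 0\<bar>"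
  shows "irreducible p"
proof (rule irreducibleI)
  let ?\<phi> = "peval of_int (\<lambda>v. [:\<alpha> v, \<beta> v:]) :: ('v, int) mpol \<Rightarrow> int poly"
  have f0: "coeff f 0 \<noteq> 0" "\<bar>coeff f 0\<bar> \<noteq> 1" using prime by auto
  then show "p \<noteq> 0" by (auto simp: f_def)
  have mult0: "coeff (?\<phi> (a * b)) 0 = coeff (?\<phi> a) 0 * coeff (?\<phi> b) 0" for a b
    by (simp add: of_int_hom.peval_mult coeff_mult)
  show "\<not> p dvd 1"
  proof
    assume "p dvd 1"
    then obtain q where "1 = p * q" by (auto elim: dvdE)
    then have "1 = coeff f 0 * coeff (?\<phi> q) 0"
      using mult0[of p q] by (simp add: f_def)
    then have "coeff f 0 dvd 1" by (metis dvd_triv_left)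
    with f0 show False by simp
  qed
  have const_unit: "g dvd 1"
    if fact: "p = g * h" and low: "degree (?\<phi> g) = 0" "\<bar>coeff (?\<phi> g) 0\<bar> = 1" for g h
  proof -
    obtain N where N: "\<And>m v. m \<in> Poly_Mapping.keys g \<union> Poly_Mapping.keys h \<Longrightarrow> Poly_Mapping.lookup m v < N"
      using exponents_bounded[of "Poly_Mapping.keys g \<union> Poly_Mapping.keys h"] by auto
    obtain idx :: "'v \<Rightarrow> nat" where idx: "inj idx" using finite_type_inj_nat by blast
    let ?\<Psi> = "graded_kronecker N idx"
    have f_fact: "f = ?\<phi> g * ?\<phi> h" by (simp add: f_def fact of_int_hom.peval_mult)
    have \<Psi>_fact: "?\<Psi> p = ?\<Psi> g * ?\<Psi> h"
      by (simp add: fact graded_kronecker_def of_int_hom.peval_mult)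
    have "p \<noteq> 0" using f0 by (auto simp: f_def)
    have le: "degree (?\<phi> q) \<le> degree (?\<Psi> q)" if "q = g \<or> q = h" for q
      unfolding of_int_hom.peval_superset[OF finite_keys order_refl]
    proof (intro degree_sum_le)
      fix m assume m: "m \<in> Poly_Mapping.keys q"
      have "degree (of_int (Poly_Mapping.lookup q m) * monom_val (\<lambda>v. [:\<alpha> v, \<beta> v:]) m) \<le> monom_degree m"
        by (rule order_trans[OF degree_mult_le]) (simp add: degree_monom_val_line)
      also have "monom_degree m \<le> degree (?\<Psi> q)"
        by (rule monom_degree_le_degree_graded_kronecker[OF idx _ m]) (use N that in auto)
      finally show "degree (of_int (Poly_Mapping.lookup q m) * monom_val (\<lambda>v. [:\<alpha> v, \<beta> v:]) m) \<le> degree (?\<Psi> q)" .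
    qed simp
    have nz: "q \<noteq> 0 \<Longrightarrow> ?\<Psi> q \<noteq> 0" if "q = g \<or> q = h" for q
      by (rule graded_kronecker_nonzero[OF idx]) (use N that in auto)
    have "?\<phi> g \<noteq> 0" "?\<phi> h \<noteq> 0" using f0 f_fact by auto
    then have "degree f = degree (?\<phi> g) + degree (?\<phi> h)"
      by (simp add: f_fact degree_mult_eq)
    moreover have "degree (?\<Psi> g) + degree (?\<Psi> h) \<le> d"
    proof -
      have "g \<noteq> 0" "h \<noteq> 0" using \<open>p \<noteq> 0\<close> by (auto simp: fact)
      with nz have "?\<Psi> g \<noteq> 0" "?\<Psi> h \<noteq> 0" by blast+
      then show ?thesis
        using degree_graded_kronecker_homogeneous[OF hom, of N idx]
        by (simp add: \<Psi>_fact degree_mult_eq)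
    qed
    ultimately have "degree (?\<Psi> g) = 0"
      using le[of g] le[of h] deg low by simp
    then have "m = 0" if "m \<in> Poly_Mapping.keys g" for m
      using monom_degree_le_degree_graded_kronecker[OF idx _ that, of N] N by (simp add: monom_degree_0_iff)
    then have "Poly_Mapping.lookup g m = Poly_Mapping.lookup (Const (Poly_Mapping.lookup g 0)) m" for m
      by (auto simp: Const_def lookup_single when_def in_keys_iff)
    then have g: "g = Const (Poly_Mapping.lookup g 0)"
      by (intro poly_mapping_eqI)
    have "\<bar>Poly_Mapping.lookup g 0\<bar> = 1"
      using low(2) by (subst (asm) g) (simp add: of_int_poly)
    then have "Const (Poly_Mapping.lookup g 0) * Const (Poly_Mapping.lookup g 0) = (1 :: ('v, int) mpol)"
      by (simp add: Const_def mult_single abs_if zmult_eq_1_iff split: if_splits)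
    then show "g dvd 1" by (subst g) (rule dvdI[OF sym])
  qed
  fix g h assume fact: "p = g * h"
  have "f = ?\<phi> g * ?\<phi> h" by (simp add: f_def fact of_int_hom.peval_mult)
  from dominant_prime_factor[of "?\<phi> g" "?\<phi> h", folded this, unfolded deg, OF prime dominant]
  show "g dvd 1 \<or> h dvd 1"
    using const_unit[OF fact] const_unit[OF fact[unfolded mult.commute[of g h]]] by blast
qed

text \<open>A common divisor of all coefficients divides all coefficients of the restriction. If it is not a unit,
it is a multiple of the prime constant term, which is too large to divide the leading coefficient.\<close>

lemma primitive_by_line:
  fixes p :: "('v, int) mpol" and \<alpha> \<beta> :: "'v \<Rightarrow> int"
  defines "f \<equiv> peval of_int (\<lambda>v. [:\<alpha> v, \<beta> v:]) p"
  assumes deg: "degree f = d" "d > 0"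
    and prime: "prime \<bar>coeff f 0\<bar>"
    and dominant: "(\<Sum>i=1..d. \<bar>coeff f i\<bar>) < \<bar>coeff f 0\<bar>"
    and k: "\<And>m. k dvd Poly_Mapping.lookup p m"
  shows "is_unit k"
proof (rule ccontr)
  assume nonunit: "\<not> is_unit k"
  have dvd: "k dvd coeff f i" for i
    unfolding f_def of_int_hom.peval_superset[OF finite_keys order_refl] coeff_sum
    by (intro dvd_sum) (simp add: of_int_poly k)
  have "k dvd \<bar>coeff f 0\<bar>" using dvd[of 0] by simp
  then have "\<bar>coeff f 0\<bar> dvd k"
    using prime nonunit irreducible_altdef[of "\<bar>coeff f 0\<bar>"] prime_elem_imp_irreducible[OF prime_imp_prime_elem]
    by blast
  then have "\<bar>coeff f 0\<bar> dvd coeff f d" using dvd[of d] dvd_trans by blast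
  moreover have "coeff f d \<noteq> 0" using deg by auto
  ultimately have "\<bar>coeff f 0\<bar> \<le> \<bar>coeff f d\<bar>"
    by (intro dvd_imp_le_int) auto
  also have "\<bar>coeff f d\<bar> \<le> (\<Sum>i=1..d. \<bar>coeff f i\<bar>)"
    using deg(2) by (intro member_le_sum) auto
  finally show False using dominant by simp
qed

section \<open>Counting terms by Kronecker substitution\<close>

text \<open>Strictly increasing exponents and no zero coefficients: the entries of such a list are exactly the
terms of its value.\<close>

fun sparse_normal :: "(int \<times> int) list \<Rightarrow> bool" where
  "sparse_normal [] = True"
| "sparse_normal [x] = (snd x \<noteq> 0)"
| "sparse_normal (x # y # xs) = (fst x < fst y \<and> snd x \<noteq> 0 \<and> sparse_normal (y # xs))"

text \<open>The element \<open>Poly_Mapping.single k 1\<close> of the group ring of the integers is the power \<open>x^k\<close> of one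
indeterminate. Integers as exponents, rather than natural numbers, are computed with in binary.\<close>

definition laurent :: "(int \<times> int) list \<Rightarrow> int \<Rightarrow>\<^sub>0 int" where
  "laurent xs = (\<Sum>(k, c)\<leftarrow>xs. Poly_Mapping.single k c)"

lemma laurent_simps [simp]:
  "laurent [] = 0" "laurent ((k, c) # xs) = Poly_Mapping.single k c + laurent xs"
  by (simp_all add: laurent_def)

lemma sparse_normal_Cons:
  "sparse_normal (x # xs) \<longleftrightarrow> snd x \<noteq> 0 \<and> (\<forall>y\<in>set xs. fst x < fst y) \<and> sparse_normal xs"
  by (induction xs arbitrary: x rule: sparse_normal.induct) (auto intro: less_trans)

lemma lookup_laurent_absent: "k \<notin> fst ` set xs \<Longrightarrow> Poly_Mapping.lookup (laurent xs) k = 0"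
  by (induction xs) (auto simp: lookup_add lookup_single when_def)

lemma lookup_laurent:
  "sparse_normal xs \<Longrightarrow> (k, c) \<in> set xs \<Longrightarrow> Poly_Mapping.lookup (laurent xs) k = c"
proof (induction xs)
  case (Cons x xs)
  show ?case
  proof (cases "x = (k, c)")
    case True
    with Cons.prems have "k \<notin> fst ` set xs"
      by (auto simp: sparse_normal_Cons)
    with True show ?thesis by (simp add: lookup_add lookup_laurent_absent)
  next
    case False
    with Cons.prems have "fst x < k" "(k, c) \<in> set xs" "sparse_normal xs"
      by (auto simp: sparse_normal_Cons)
    with Cons.IH show ?thesis by (cases x) (auto simp: lookup_add lookup_single)
  qed
qed simp

lemma sparse_normal_nonzero: "sparse_normal xs \<Longrightarrow> (k, c) \<in> set xs \<Longrightarrow> c \<noteq> 0"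
  by (induction xs) (auto simp: sparse_normal_Cons)

lemma sparse_normal_distinct: "sparse_normal xs \<Longrightarrow> distinct (map fst xs)"
  by (induction xs) (auto simp: sparse_normal_Cons)

lemma card_keys_laurent:
  assumes "sparse_normal xs"
  shows "card (Poly_Mapping.keys (laurent xs)) = length xs"
proof -
  have "Poly_Mapping.keys (laurent xs) = fst ` set xs"
  proof (intro set_eqI iffI)
    fix k assume "k \<in> Poly_Mapping.keys (laurent xs)"
    then show "k \<in> fst ` set xs" using lookup_laurent_absent[of k xs] by (auto simp: in_keys_iff)
  next
    fix k assume "k \<in> fst ` set xs"
    then show "k \<in> Poly_Mapping.keys (laurent xs)"
      using lookup_laurent[OF assms] sparse_normal_nonzero[OF assms] by (force simp: in_keys_iff)
  qed
  then have "card (Poly_Mapping.keys (laurent xs)) = card (set (map fst xs))" by simp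
  also have "\<dots> = length xs" using distinct_card[OF sparse_normal_distinct[OF assms]] by simp
  finally show ?thesis .
qed

definition kronecker :: "nat \<Rightarrow> ('v \<Rightarrow> nat) \<Rightarrow> ('v, int) mpol \<Rightarrow> int \<Rightarrow>\<^sub>0 int" where
  "kronecker N idx = peval of_int (\<lambda>v. Poly_Mapping.single (int N ^ idx v) 1)"

lemma monom_val_laurent:
  "monom_val (\<lambda>v. Poly_Mapping.single (int N ^ idx v) (1 :: int)) m =
     Poly_Mapping.single (int (kronecker_code N idx m)) 1"
proof -
  have power: "Poly_Mapping.single k (1::int) ^ n = Poly_Mapping.single (k * int n) 1" for k :: int and n
    by (induction n) (simp_all add: mult_single algebra_simps)
  have "(\<Prod>v\<in>A. Poly_Mapping.single (int N ^ idx v) (1 :: int) ^ f v)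
      = Poly_Mapping.single (int (\<Sum>v\<in>A. N ^ idx v * f v)) 1" if "finite A" for A and f :: "'a \<Rightarrow> nat"
    using that by (induction A) (simp_all add: power mult_single)
  then show ?thesis by (simp add: monom_val_def kronecker_code_def)
qed

lemma kronecker_sum:
  "kronecker N idx p =
     (\<Sum>m\<in>Poly_Mapping.keys p. Poly_Mapping.single (int (kronecker_code N idx m)) (Poly_Mapping.lookup p m))"
  unfolding kronecker_def of_int_hom.peval_superset[OF finite_keys order_refl] monom_val_laurent
  by (simp add: mult_single flip: single_of_int)

lemma lookup_kronecker:
  fixes p :: "('v::finite, int) mpol"
  assumes "inj idx" and "\<And>m v. m \<in> Poly_Mapping.keys p \<Longrightarrow> Poly_Mapping.lookup m v < N"
    and "\<And>v. Poly_Mapping.lookup m v < N"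
  shows "Poly_Mapping.lookup (kronecker N idx p) (int (kronecker_code N idx m)) = Poly_Mapping.lookup p m"
proof -
  have "Poly_Mapping.lookup (kronecker N idx p) (int (kronecker_code N idx m))
      = (\<Sum>m'\<in>Poly_Mapping.keys p. if m' = m then Poly_Mapping.lookup p m' else 0)"
    unfolding kronecker_sum lookup_sum
    by (intro sum.cong) (use kronecker_code_inj[OF assms(1,2,3)] in \<open>auto simp: lookup_single when_def\<close>)
  then show ?thesis by (simp add: in_keys_iff)
qed

lemma num_terms_kronecker:
  fixes p :: "('v::finite, int) mpol"
  assumes idx: "inj idx" and N: "\<And>m v. m \<in> Poly_Mapping.keys p \<Longrightarrow> Poly_Mapping.lookup m v < N"
  shows "card (Poly_Mapping.keys (kronecker N idx p)) = num_terms p"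
proof -
  let ?k = "\<lambda>m. int (kronecker_code N idx m)"
  have "Poly_Mapping.keys (kronecker N idx p) = ?k ` Poly_Mapping.keys p"
  proof (intro set_eqI iffI)
    fix i assume "i \<in> Poly_Mapping.keys (kronecker N idx p)"
    then have "Poly_Mapping.lookup (kronecker N idx p) i \<noteq> 0" by (simp add: in_keys_iff)
    then obtain m where "m \<in> Poly_Mapping.keys p"
      "Poly_Mapping.lookup (Poly_Mapping.single (?k m) (Poly_Mapping.lookup p m)) i \<noteq> 0"
      unfolding kronecker_sum lookup_sum by (rule sum.not_neutral_contains_not_neutral)
    then have "m \<in> Poly_Mapping.keys p" "i = ?k m"
      by (auto simp: lookup_single when_def split: if_splits)
    then show "i \<in> ?k ` Poly_Mapping.keys p" by blast
  next
    fix i assume "i \<in> ?k ` Poly_Mapping.keys p"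
    then show "i \<in> Poly_Mapping.keys (kronecker N idx p)"
      using lookup_kronecker[OF idx N N] by (auto simp: in_keys_iff)
  qed
  moreover have "inj_on ?k (Poly_Mapping.keys p)"
    by (intro inj_onI kronecker_code_inj[OF idx N N]) auto
  ultimately show ?thesis by (simp add: card_image num_terms_def)
qed

text \<open>The coefficients of a sparse polynomial may be sparse polynomials again; \<open>V\<close> interprets them.\<close>

definition sparse_value :: "('c \<Rightarrow> int \<Rightarrow>\<^sub>0 int) \<Rightarrow> (int \<times> 'c) list \<Rightarrow> int \<Rightarrow>\<^sub>0 int" where
  "sparse_value V xs = (\<Sum>(k, c)\<leftarrow>xs. Poly_Mapping.single k 1 * V c)"

definition cons_nonzero :: "('c \<Rightarrow> bool) \<Rightarrow> int \<Rightarrow> 'c \<Rightarrow> (int \<times> 'c) list \<Rightarrow> (int \<times> 'c) list" where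
  "cons_nonzero isz k c xs = (if isz c then xs else (k, c) # xs)"

fun sparse_add :: "('c \<Rightarrow> 'c \<Rightarrow> 'c) \<Rightarrow> ('c \<Rightarrow> bool) \<Rightarrow>
    (int \<times> 'c) list \<Rightarrow> (int \<times> 'c) list \<Rightarrow> (int \<times> 'c) list" where
  "sparse_add add isz [] ys = ys"
| "sparse_add add isz (x # xs) [] = x # xs"
| "sparse_add add isz ((k, c) # xs) ((l, d) # ys) =
     (if k < l then (k, c) # sparse_add add isz xs ((l, d) # ys)
      else if l < k then (l, d) # sparse_add add isz ((k, c) # xs) ys
      else cons_nonzero isz k (add c d) (sparse_add add isz xs ys))"

fun sparse_mult :: "('c \<Rightarrow> 'c \<Rightarrow> 'c) \<Rightarrow> ('c \<Rightarrow> 'c \<Rightarrow> 'c) \<Rightarrow> ('c \<Rightarrow> bool) \<Rightarrow>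
    (int \<times> 'c) list \<Rightarrow> (int \<times> 'c) list \<Rightarrow> (int \<times> 'c) list" where
  "sparse_mult add mul isz [] ys = []"
| "sparse_mult add mul isz ((k, c) # xs) ys =
     sparse_add add isz (map (\<lambda>(l, d). (k + l, mul c d)) ys) (sparse_mult add mul isz xs ys)"

lemma sparse_value_simps [simp]:
  "sparse_value V [] = 0"
  "sparse_value V ((k, c) # xs) = Poly_Mapping.single k 1 * V c + sparse_value V xs"
  by (simp_all add: sparse_value_def)

lemma sparse_value_add:
  assumes "\<And>c d. V (add c d) = V c + V d" "\<And>c. isz c \<Longrightarrow> V c = 0"
  shows "sparse_value V (sparse_add add isz xs ys) = sparse_value V xs + sparse_value V ys"
  using assms
proof (induction add isz xs ys rule: sparse_add.induct)
  case (3 add isz k c xs l d ys)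
  have merge: "sparse_value V (cons_nonzero isz k (add c d) zs)
      = Poly_Mapping.single k 1 * V c + Poly_Mapping.single k 1 * V d + sparse_value V zs" for zs
  proof (cases "isz (add c d)")
    case True
    then have "V c + V d = 0" using 3(4,5) by metis
    then show ?thesis using True by (simp add: cons_nonzero_def flip: distrib_left)
  qed (simp add: cons_nonzero_def 3(4) ring_distribs)
  show ?case
  proof (rule linorder_cases[of k l])
    assume "k < l"
    then show ?thesis using 3 by (simp add: add_ac)
  next
    assume "l < k"
    then show ?thesis using 3 by (simp add: add_ac)
  next
    assume "k = l"
    then show ?thesis using 3 merge by (simp add: add_ac)
  qed
qed auto

lemma sparse_value_mult:
  assumes "\<And>c d. V (add c d) = V c + V d" "\<And>c d. V (mul c d) = V c * V d" "\<And>c. isz c \<Longrightarrow> V c = 0"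
  shows "sparse_value V (sparse_mult add mul isz xs ys) = sparse_value V xs * sparse_value V ys"
  using assms
proof (induction add mul isz xs ys rule: sparse_mult.induct)
  case (2 add mul isz k c xs ys)
  have "sparse_value V (map (\<lambda>(l, d). (k + l, mul c d)) ys) = Poly_Mapping.single k 1 * V c * sparse_value V ys"
  proof (induction ys)
    case (Cons y ys)
    have "Poly_Mapping.single (k + fst y) (1 :: int) = Poly_Mapping.single k 1 * Poly_Mapping.single (fst y) 1"
      by (simp add: mult_single)
    with Cons 2(3) show ?case by (cases y) (simp add: algebra_simps)
  qed simp
  then show ?case
    using 2 by (simp add: sparse_value_add[OF 2(2) 2(4)] ring_distribs)
qed simp

definition add1 :: "(int \<times> int) list \<Rightarrow> (int \<times> int) list \<Rightarrow> (int \<times> int) list" where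
  "add1 = sparse_add (+) (\<lambda>c. c = 0)"
definition mult1 :: "(int \<times> int) list \<Rightarrow> (int \<times> int) list \<Rightarrow> (int \<times> int) list" where
  "mult1 = sparse_mult (+) (*) (\<lambda>c. c = 0)"
definition uminus1 :: "(int \<times> int) list \<Rightarrow> (int \<times> int) list" where
  "uminus1 = map (\<lambda>(k, c). (k, - c))"

text \<open>Polynomials in some of the indeterminates, the coefficients of which are polynomials in the
others. Each list is then much shorter than the list of all terms. This matters because merging two lists
by rewriting takes time quadratic in their length.\<close>

type_synonym nested = "(int \<times> (int \<times> int) list) list"

definition add2 :: "nested \<Rightarrow> nested \<Rightarrow> nested" where
  "add2 = sparse_add add1 (\<lambda>xs. xs = [])"
definition mult2 :: "nested \<Rightarrow> nested \<Rightarrow> nested" where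
  "mult2 = sparse_mult add1 mult1 (\<lambda>xs. xs = [])"
definition uminus2 :: "nested \<Rightarrow> nested" where
  "uminus2 = map (\<lambda>(k, c). (k, uminus1 c))"

definition value2 :: "nested \<Rightarrow> int \<Rightarrow>\<^sub>0 int" where
  "value2 = sparse_value (sparse_value of_int)"

lemma value1_add: "sparse_value of_int (add1 xs ys) = sparse_value of_int xs + sparse_value of_int ys"
  unfolding add1_def by (rule sparse_value_add) simp_all

lemma value1_mult: "sparse_value of_int (mult1 xs ys) = sparse_value of_int xs * sparse_value of_int ys"
  unfolding mult1_def by (rule sparse_value_mult) simp_all

lemma value1_uminus: "sparse_value of_int (uminus1 xs) = - sparse_value of_int xs"
  by (induction xs) (auto simp: uminus1_def)

lemma value2_add: "value2 (add2 xs ys) = value2 xs + value2 ys"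
  unfolding add2_def value2_def by (rule sparse_value_add) (auto simp: value1_add)

lemma value2_mult: "value2 (mult2 xs ys) = value2 xs * value2 ys"
  unfolding mult2_def value2_def by (rule sparse_value_mult) (auto simp: value1_add value1_mult)

lemma value2_uminus: "value2 (uminus2 xs) = - value2 xs"
  unfolding value2_def by (induction xs) (auto simp: uminus2_def value1_uminus)

text \<open>Backward application of these rules translates a ring expression into a computation with
lists. The rule for exponents of the form \<open>N ^ (4 + e)\<close> comes before the one for arbitrary
exponents: it assigns the indeterminates with index at least 4 to the outer level.\<close>

lemma value2_reflect:
  "A = value2 xs \<Longrightarrow> B = value2 ys \<Longrightarrow> A + B = value2 (add2 xs ys)"
  "A = value2 xs \<Longrightarrow> B = value2 ys \<Longrightarrow> A - B = value2 (add2 xs (uminus2 ys))"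
  "A = value2 xs \<Longrightarrow> B = value2 ys \<Longrightarrow> A * B = value2 (mult2 xs ys)"
  "A = value2 xs \<Longrightarrow> - A = value2 (uminus2 xs)"
  "numeral n = value2 [(0, [(0, numeral n)])]"
  "Poly_Mapping.single (N ^ (4 + e)) 1 = value2 [(N ^ (4 + e), [(0, 1)])]"
  "Poly_Mapping.single k 1 = value2 [(0, [(k, 1)])]"
  by (simp_all add: value2_add value2_uminus value2_mult) (simp_all add: value2_def mult_single)

definition flatten :: "nested \<Rightarrow> (int \<times> int) list" where
  "flatten xs = concat (map (\<lambda>(k, ys). map (\<lambda>(l, c). (k + l, c)) ys) xs)"

lemma laurent_append: "laurent (xs @ ys) = laurent xs + laurent ys"
  by (simp add: laurent_def)

lemma laurent_flatten: "laurent (flatten xs) = value2 xs"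
proof (induction xs)
  case (Cons x xs)
  obtain k ys where x: "x = (k, ys)" by fastforce
  have "laurent (map (\<lambda>(l, c). (k + l, c)) ys) = Poly_Mapping.single k 1 * sparse_value of_int ys"
    by (induction ys) (auto simp: ring_distribs mult_single simp flip: single_of_int)
  with Cons x show ?case by (simp add: flatten_def value2_def laurent_append)
qed (simp add: flatten_def value2_def)

text \<open>The terms \<open>ts\<close> are asked for together with the normal form, so that one expansion answers both
questions.\<close>

definition normal_check :: "nat \<Rightarrow> (int \<times> int) list \<Rightarrow> (int \<times> int) list \<Rightarrow> bool" where
  "normal_check n ts xs \<longleftrightarrow> sparse_normal xs \<and> length xs = n \<and> (\<forall>t\<in>set ts. t \<in> set xs)"

definition nested_check :: "nat \<Rightarrow> (int \<times> int) list \<Rightarrow> nested \<Rightarrow> bool" where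
  "nested_check n ts xs \<longleftrightarrow> normal_check n ts (flatten xs)"

lemma num_terms_if_nested_check:
  fixes p :: "('v::finite, int) mpol"
  assumes "inj idx" "homogeneous d p" "d < N"
    and "kronecker N idx p = value2 xs" "nested_check n ts xs"
  shows "num_terms p = n"
proof -
  have "kronecker N idx p = laurent (flatten xs)" by (simp add: laurent_flatten assms(4))
  moreover have "sparse_normal (flatten xs)" "length (flatten xs) = n"
    using assms(5) by (simp_all add: nested_check_def normal_check_def)
  ultimately show ?thesis
    using num_terms_kronecker[OF assms(1), of p N] exponent_less_if_homogeneous[OF assms(2) _ assms(3)]
    by (simp add: card_keys_laurent)
qed

lemma lookup_if_nested_check:
  fixes p :: "('v::finite, int) mpol"
  assumes "inj idx" "homogeneous d p" "d < N" "\<And>v. Poly_Mapping.lookup m v < N"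
    and "kronecker N idx p = value2 xs" "nested_check n [(int (kronecker_code N idx m), c)] xs"
  shows "Poly_Mapping.lookup p m = c"
proof -
  have "kronecker N idx p = laurent (flatten xs)" by (simp add: laurent_flatten assms(5))
  moreover have "sparse_normal (flatten xs)" "(int (kronecker_code N idx m), c) \<in> set (flatten xs)"
    using assms(6) by (simp_all add: nested_check_def normal_check_def)
  ultimately show ?thesis
    using lookup_kronecker[OF assms(1), of p N m] exponent_less_if_homogeneous[OF assms(2) _ assms(3)] assms(4)
    by (simp add: lookup_laurent)
qed

section \<open>The discriminant and the invariant I\<close>

text \<open>With \<open>u = c\<^sub>3\<close>, \<open>v = c\<^sub>4\<close>, \<open>s = c\<^sub>7\<close>, \<open>p = c\<^sub>1 c\<^sub>5\<close>, \<open>q = c\<^sub>1 c\<^sub>6 + c\<^sub>2 c\<^sub>5\<close> and \<open>r = c\<^sub>2 c\<^sub>6\<close>, the double cover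
of the line is \<open>w\<^sup>2 + (u y\<^sup>2 + s y z + v z\<^sup>2) w + (p y\<^sup>3 z + q y\<^sup>2 z\<^sup>2 + r y z\<^sup>3) = 0\<close>. Its Jacobian is
the Weierstrass cubic with \<open>a\<^sub>1 = s\<close>, \<open>a\<^sub>2 = - (q + u v)\<close>, \<open>a\<^sub>3 = - (u r + p v)\<close>, \<open>a\<^sub>4 = u v q + p r\<close> and
\<open>a\<^sub>6 = - u v p r\<close>. The forms below are Tate's \<open>b\<^sub>2\<close>, \<open>b\<^sub>4\<close>, \<open>b\<^sub>6\<close>, \<open>b\<^sub>8\<close>, discriminant and \<open>c\<^sub>4\<close> of this cubic;
\<open>b\<^sub>6 = a\<^sub>3\<^sup>2 + 4 a\<^sub>6\<close> happens to be a square. They are expressions over an arbitrary commutative ring, so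
that the same definition serves for indeterminates, for complex numbers, for restrictions to lines
and for Kronecker's substitution.\<close>

definition b2_form :: "(cubic_coeff \<Rightarrow> 'a::comm_ring_1) \<Rightarrow> 'a" where
  "b2_form c = c C7 * c C7 - 4 * (c C1 * c C6 + c C2 * c C5 + c C3 * c C4)"

definition b4_form :: "(cubic_coeff \<Rightarrow> 'a::comm_ring_1) \<Rightarrow> 'a" where
  "b4_form c = 2 * (c C3 * c C4 * (c C1 * c C6 + c C2 * c C5))
     - c C7 * (c C2 * c C3 * c C6 + c C1 * c C4 * c C5) + 2 * (c C1 * c C2 * c C5 * c C6)"

definition b6_root_form :: "(cubic_coeff \<Rightarrow> 'a::comm_ring_1) \<Rightarrow> 'a" where
  "b6_root_form c = c C2 * c C3 * c C6 - c C1 * c C4 * c C5"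

definition b6_form :: "(cubic_coeff \<Rightarrow> 'a::comm_ring_1) \<Rightarrow> 'a" where
  "b6_form c = b6_root_form c * b6_root_form c"

definition b8_form :: "(cubic_coeff \<Rightarrow> 'a::comm_ring_1) \<Rightarrow> 'a" where
  "b8_form c =
     (let a1 = c C7; a2 = - (c C1 * c C6 + c C2 * c C5 + c C3 * c C4);
          a3 = - (c C2 * c C3 * c C6 + c C1 * c C4 * c C5);
          a4 = c C3 * c C4 * (c C1 * c C6 + c C2 * c C5) + c C1 * c C2 * c C5 * c C6;
          a6 = - (c C1 * c C2 * c C3 * c C4 * c C5 * c C6)
      in (a1 * a1 + 4 * a2) * a6 - a1 * a3 * a4 + a2 * a3 * a3 - a4 * a4)"

definition discriminant_form :: "(cubic_coeff \<Rightarrow> 'a::comm_ring_1) \<Rightarrow> 'a" where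
  "discriminant_form c =
     9 * (b2_form c * b4_form c * b6_form c) - b2_form c * b2_form c * b8_form c
     - 8 * (b4_form c * b4_form c * b4_form c) - 27 * (b6_form c * b6_form c)"

definition c4_form :: "(cubic_coeff \<Rightarrow> 'a::comm_ring_1) \<Rightarrow> 'a" where
  "c4_form c = b2_form c * b2_form c - 24 * b4_form c"

fun spohn_form :: "(payoff_var \<Rightarrow> 'a::comm_ring_1) \<Rightarrow> cubic_coeff \<Rightarrow> 'a" where
  "spohn_form e C1 = (e (PayA 1 1) - e (PayA 2 2)) * (e (PayB 1 1) - e (PayB 1 2))"
| "spohn_form e C2 = (e (PayA 1 1) - e (PayA 2 1)) * (e (PayB 2 2) - e (PayB 1 1))"
| "spohn_form e C3 = (e (PayA 1 2) - e (PayA 2 2)) * (e (PayB 1 1) - e (PayB 1 2))"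
| "spohn_form e C4 = (e (PayA 1 1) - e (PayA 2 1)) * (e (PayB 2 2) - e (PayB 2 1))"
| "spohn_form e C5 = (e (PayA 1 2) - e (PayA 2 2)) * (e (PayB 2 1) - e (PayB 1 2))"
| "spohn_form e C6 = (e (PayA 1 2) - e (PayA 2 1)) * (e (PayB 2 2) - e (PayB 2 1))"
| "spohn_form e C7 =
     (e (PayA 1 2) - e (PayA 2 1)) * (e (PayB 2 2) - e (PayB 1 1)) +
     (e (PayA 1 1) - e (PayA 2 2)) * (e (PayB 2 1) - e (PayB 1 2))"

lemma spohn_coeff_eq: "spohn_coeff a b = spohn_form (payoff_entry a b)"
proof
  fix k show "spohn_coeff a b k = spohn_form (payoff_entry a b) k" by (cases k) simp_all
qed

lemmas form_defs = discriminant_form_def c4_form_def b2_form_def b4_form_def b6_form_def b8_form_def b6_root_form_def Let_def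

definition cubic_discriminant :: "(cubic_coeff, int) mpol" where
  "cubic_discriminant = discriminant_form Var"

definition spohn_invariant :: "(payoff_var, int) mpol" where
  "spohn_invariant = c4_form (spohn_form Var)"

lemma peval_cubic_discriminant: "peval of_int \<sigma> cubic_discriminant = discriminant_form \<sigma>"
  by (simp add: cubic_discriminant_def form_defs of_int_hom.peval_ring)

lemma peval_spohn_invariant: "peval of_int \<sigma> spohn_invariant = c4_form (spohn_form \<sigma>)"
  by (simp add: spohn_invariant_def form_defs of_int_hom.peval_ring)

lemma UNIV_cubic_coeff: "UNIV = {C1, C2, C3, C4, C5, C6, C7}"
  using cubic_coeff.exhaust by blast

instance cubic_coeff :: finite
  by standard (simp add: UNIV_cubic_coeff)

instance payoff_var :: finite
proof
  have "(UNIV :: payoff_var set) = case_prod PayA ` UNIV \<union> case_prod PayB ` UNIV"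
    by (auto simp: image_iff) (metis payoff_var.exhaust)
  then show "finite (UNIV :: payoff_var set)" by (metis finite finite_UnI finite_imageI)
qed

text \<open>The indices from 4 on are written as sums for the sake of the rules \<open>value2_reflect\<close>.\<close>

fun coeff_index :: "cubic_coeff \<Rightarrow> nat" where
  "coeff_index C1 = 0" | "coeff_index C2 = 1" | "coeff_index C3 = 2" | "coeff_index C4 = 3"
| "coeff_index C5 = 4 + 0" | "coeff_index C6 = 4 + 1" | "coeff_index C7 = 4 + 2"

lemma inj_coeff_index: "inj coeff_index"
proof (rule injI)
  show "coeff_index x = coeff_index y \<Longrightarrow> x = y" for x y by (cases x; cases y) simp_all
qed

text \<open>The entries of the two payoff tables are separated: the outer level of the nested lists holds the
\<open>a\<^sub>i\<^sub>j\<close>, the inner one the \<open>b\<^sub>i\<^sub>j\<close>. The invariant has degree 4 in either group.\<close>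

fun payoff_index :: "payoff_var \<Rightarrow> nat" where
  "payoff_index (PayA i j) = 4 + ((if i = 1 then 0 else 2) + (if j = 1 then 0 else 1))"
| "payoff_index (PayB i j) = (if i = 1 then 0 else 2) + (if j = 1 then 0 else 1)"

lemma inj_payoff_index: "inj payoff_index"
proof (rule injI)
  show "payoff_index x = payoff_index y \<Longrightarrow> x = y" for x y
    by (cases x; cases y) (auto split: if_splits simp: forall_2 | metis exhaust_2)+
qed

text \<open>The pair is the term \<open>16 c\<^sub>1\<^sup>5 c\<^sub>4\<^sup>2 c\<^sub>5\<^sup>2 c\<^sub>6\<^sup>3\<close>, whose exponents are the digits of the number in base 16.\<close>

lemma cubic_discriminant_terms: "\<exists>xs. kronecker 16 coeff_index cubic_discriminant = value2 xs \<and> nested_check 127 [(5 + 2 * 16^3 + 2 * 16^4 + 3 * 16^5, 16)] xs"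
  unfolding kronecker_def peval_cubic_discriminant form_defs coeff_index.simps of_nat_numeral
  apply (rule exI, rule conjI)
   apply (rule value2_reflect)+
  apply code_simp
  done

lemma payoff_index_values:
  "payoff_index (PayA 1 1) = 4 + 0" "payoff_index (PayA 1 2) = 4 + 1"
  "payoff_index (PayA 2 1) = 4 + 2" "payoff_index (PayA 2 2) = 4 + 3"
  "payoff_index (PayB 1 1) = 0" "payoff_index (PayB 1 2) = 1"
  "payoff_index (PayB 2 1) = 2" "payoff_index (PayB 2 2) = 3"
  by simp_all

lemma spohn_invariant_terms: "\<exists>xs. kronecker 16 payoff_index spohn_invariant = value2 xs \<and> nested_check 633 [] xs"
  unfolding kronecker_def peval_spohn_invariant form_defs spohn_form.simps payoff_index_values of_nat_numeral
  apply (rule exI, rule conjI)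
   apply (rule value2_reflect)+
  apply code_simp
  done

section \<open>Terms and irreducibility of the discriminant and of I\<close>

lemma homogeneous_cubic_discriminant: "homogeneous 12 cubic_discriminant"
proof -
  have "\<exists>d. homogeneous d cubic_discriminant \<and> d = 12"
    unfolding cubic_discriminant_def form_defs
    apply (rule exI, rule conjI)
     apply (rule homogeneous_intros | simp; fail)+
    done
  then show ?thesis by simp
qed

lemma homogeneous_spohn_invariant: "homogeneous 8 spohn_invariant"
proof -
  have "\<exists>d. homogeneous d spohn_invariant \<and> d = 8"
    unfolding spohn_invariant_def form_defs spohn_form.simps
    apply (rule exI, rule conjI)
     apply (rule homogeneous_intros | simp; fail)+
    done
  then show ?thesis by simp
qed

lemma prime_if_no_small_divisor:
  fixes n k :: int
  assumes "1 < n" "0 \<le> k" "n < (k + 1) * (k + 1)" "\<forall>d\<in>set [2..k]. n mod d \<noteq> 0"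
  shows "prime n"
proof (rule ccontr)
  assume not_prime: "\<not> prime n"
  obtain p where p: "prime p" "p dvd n" using assms(1) prime_factor_int[of n] by auto
  then obtain q where q: "n = p * q" by (elim dvdE)
  have p2: "p \<ge> 2" using prime_ge_2_int[OF p(1)] .
  have "0 < p * q" using q assms(1) by simp
  then have "q > 0" using p2 by (simp add: zero_less_mult_iff)
  moreover have "q \<noteq> 1" using q p not_prime by auto
  ultimately have q2: "q \<ge> 2" by simp
  have no_divisor: "k < d" if "2 \<le> d" "d dvd n" for d
  proof (rule ccontr)
    assume "\<not> k < d"
    with assms(4) that(1) have "n mod d \<noteq> 0" by auto
    with that(2) show False by (simp add: dvd_eq_mod_eq_0)
  qed
  have "k < p" "k < q" using no_divisor[OF p2 p(2)] no_divisor[OF q2] q by simp_all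
  then have "(k + 1) * (k + 1) \<le> p * q"
    using p2 q2 assms(2) by (intro mult_mono) auto
  with assms(3) q show False by simp
qed

lemma prime_97423: "prime (97423 :: int)"
proof (rule prime_if_no_small_divisor)
  show "\<forall>d\<in>set [2..312]. (97423 :: int) mod d \<noteq> 0" by code_simp
qed simp_all

lemma prime_193: "prime (193 :: int)"
proof (rule prime_if_no_small_divisor)
  show "\<forall>d\<in>set [2..13]. (193 :: int) mod d \<noteq> 0" by code_simp
qed simp_all

text \<open>The two lines come from a random search for a restriction with a small dominant prime constant
term.\<close>

definition discriminant_line :: "cubic_coeff \<Rightarrow> int poly" where
  "discriminant_line v = [:[- 1, 1, 2, 2, 3, 1, 1] ! coeff_index v, [0, - 1, - 1, 0, 1, 1, 0] ! coeff_index v:]"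

definition spohn_line :: "payoff_var \<Rightarrow> int poly" where
  "spohn_line v = [:[3, 4, 5, 3, 3, 1, 1, 2] ! payoff_index v, [1, 1, 0, 1, - 1, - 2, - 2, - 2] ! payoff_index v:]"

lemma cubic_discriminant_on_line: "peval of_int discriminant_line cubic_discriminant
  = [:-97423, -2917, -29600, 16810, -4015, 7388, -1768, 2650, -1519, -287, -104, 220, -43 :: int:]"
  unfolding peval_cubic_discriminant form_defs discriminant_line_def coeff_index.simps
  by (simp add: numeral_poly)

lemma spohn_invariant_on_line: "peval of_int spohn_line spohn_invariant
  = [:193, 0, 12, 0, -74, 0, 12, 0, 1 :: int:]"
  unfolding peval_spohn_invariant form_defs spohn_form.simps spohn_line_def payoff_index_values
  by (simp add: numeral_poly)

lemma cubic_discriminant_on_line_dominant: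
  defines "f \<equiv> peval of_int discriminant_line cubic_discriminant"
  shows "degree f = 12" "prime \<bar>coeff f 0\<bar>" "(\<Sum>i=1..12. \<bar>coeff f i\<bar>) < \<bar>coeff f 0\<bar>"
  unfolding f_def cubic_discriminant_on_line
  by (simp_all add: prime_97423 eval_nat_numeral del: prime_int_numeral_eq)

lemma spohn_invariant_on_line_dominant:
  defines "f \<equiv> peval of_int spohn_line spohn_invariant"
  shows "degree f = 8" "prime \<bar>coeff f 0\<bar>" "(\<Sum>i=1..8. \<bar>coeff f i\<bar>) < \<bar>coeff f 0\<bar>"
  unfolding f_def spohn_invariant_on_line
  by (simp_all add: prime_193 eval_nat_numeral del: prime_int_numeral_eq)

lemma irreducible_cubic_discriminant: "irreducible cubic_discriminant"
  by (rule irreducible_by_line[OF homogeneous_cubic_discriminant cubic_discriminant_on_line_dominant[unfolded discriminant_line_def]])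

lemma primitive_cubic_discriminant: "(\<And>m. k dvd Poly_Mapping.lookup cubic_discriminant m) \<Longrightarrow> is_unit k"
  by (rule primitive_by_line[OF cubic_discriminant_on_line_dominant(1)[unfolded discriminant_line_def] _ cubic_discriminant_on_line_dominant(2,3)[unfolded discriminant_line_def]]) simp_all

lemma irreducible_spohn_invariant: "irreducible spohn_invariant"
  by (rule irreducible_by_line[OF homogeneous_spohn_invariant spohn_invariant_on_line_dominant[unfolded spohn_line_def]])

lemma lookup_cubic_discriminant:
  "Poly_Mapping.lookup cubic_discriminant (Poly_Mapping.single C1 5 + Poly_Mapping.single C4 2 +
        Poly_Mapping.single C5 2 + Poly_Mapping.single C6 3) = 16" (is "Poly_Mapping.lookup _ ?m = _")
proof -
  have code: "int (kronecker_code 16 coeff_index ?m) = 5 + 2 * 16^3 + 2 * 16^4 + 3 * 16^5"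
    by (simp add: kronecker_code_UNIV UNIV_cubic_coeff lookup_add lookup_single when_def)
  obtain xs where xs: "kronecker 16 coeff_index cubic_discriminant = value2 xs"
    "nested_check 127 [(5 + 2 * 16^3 + 2 * 16^4 + 3 * 16^5, 16)] xs"
    using cubic_discriminant_terms by blast
  show ?thesis
    by (rule lookup_if_nested_check[OF inj_coeff_index homogeneous_cubic_discriminant _ _ xs(1) xs(2)[folded code]])
       (auto simp: lookup_add lookup_single when_def)
qed

section \<open>Ternary cubics and the Aronhold invariants\<close>

text \<open>A ternary cubic is given by its coefficients at \<open>x\<^sup>3, y\<^sup>3, z\<^sup>3, x\<^sup>2y, x\<^sup>2z, xy\<^sup>2, y\<^sup>2z, xz\<^sup>2, yz\<^sup>2, xyz\<close>, in this
order, at the indices 0 to 9.\<close>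

definition cubic_value :: "(nat \<Rightarrow> complex) \<Rightarrow> complex \<Rightarrow> complex \<Rightarrow> complex \<Rightarrow> complex" where
  "cubic_value f x y z =
     f 0 * x^3 + f 1 * y^3 + f 2 * z^3 + f 3 * x^2 * y + f 4 * x^2 * z + f 5 * x * y^2
     + f 6 * y^2 * z + f 7 * x * z^2 + f 8 * y * z^2 + f 9 * x * y * z"

text \<open>The invariants of degree 4 and 6 of Aronhold, scaled to the value 1 at \<open>xyz\<close>. In terms of the
Jacobian of the cubic they are \<open>c\<^sub>4\<close> and \<open>- c\<^sub>6\<close>.\<close>

definition cubic_S :: "(nat \<Rightarrow> complex) \<Rightarrow> complex" where
  "cubic_S f =
     f 9 ^ 4 - 8 * f 5 * f 7 * f 9 ^ 2 + 16 * f 5 ^ 2 * f 7 ^ 2 - 8 * f 4 * f 6 * f 9 ^ 2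
     + 24 * f 4 * f 5 * f 8 * f 9 - 16 * f 4 * f 5 * f 6 * f 7 + 16 * f 4 ^ 2 * f 6 ^ 2
     - 8 * f 3 * f 8 * f 9 ^ 2 + 24 * f 3 * f 6 * f 7 * f 9 - 16 * f 3 * f 5 * f 7 * f 8
     - 16 * f 3 * f 4 * f 6 * f 8 + 16 * f 3 ^ 2 * f 8 ^ 2 - 48 * f 2 * f 4 * f 5 ^ 2
     + 24 * f 2 * f 3 * f 5 * f 9 - 48 * f 2 * f 3 ^ 2 * f 6 + 24 * f 1 * f 4 * f 7 * f 9
     - 48 * f 1 * f 4 ^ 2 * f 8 - 48 * f 1 * f 3 * f 7 ^ 2 + 144 * f 1 * f 2 * f 3 * f 4
     + 24 * f 0 * f 6 * f 8 * f 9 - 48 * f 0 * f 6 ^ 2 * f 7 - 48 * f 0 * f 5 * f 8 ^ 2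
     + 144 * f 0 * f 2 * f 5 * f 6 + 144 * f 0 * f 1 * f 7 * f 8 - 216 * f 0 * f 1 * f 2 * f 9"

definition cubic_T :: "(nat \<Rightarrow> complex) \<Rightarrow> complex" where
  "cubic_T f =
     f 9 ^ 6 - 12 * f 5 * f 7 * f 9 ^ 4 + 48 * f 5 ^ 2 * f 7 ^ 2 * f 9 ^ 2
     - 64 * f 5 ^ 3 * f 7 ^ 3 - 12 * f 4 * f 6 * f 9 ^ 4 + 36 * f 4 * f 5 * f 8 * f 9 ^ 3
     + 24 * f 4 * f 5 * f 6 * f 7 * f 9 ^ 2 - 144 * f 4 * f 5 ^ 2 * f 7 * f 8 * f 9
     + 96 * f 4 * f 5 ^ 2 * f 6 * f 7 ^ 2 + 48 * f 4 ^ 2 * f 6 ^ 2 * f 9 ^ 2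
     - 144 * f 4 ^ 2 * f 5 * f 6 * f 8 * f 9 + 96 * f 4 ^ 2 * f 5 * f 6 ^ 2 * f 7
     + 216 * f 4 ^ 2 * f 5 ^ 2 * f 8 ^ 2 - 64 * f 4 ^ 3 * f 6 ^ 3 - 12 * f 3 * f 8 * f 9 ^ 4
     + 36 * f 3 * f 6 * f 7 * f 9 ^ 3 + 24 * f 3 * f 5 * f 7 * f 8 * f 9 ^ 2
     - 144 * f 3 * f 5 * f 6 * f 7 ^ 2 * f 9 + 96 * f 3 * f 5 ^ 2 * f 7 ^ 2 * f 8
     + 24 * f 3 * f 4 * f 6 * f 8 * f 9 ^ 2 - 144 * f 3 * f 4 * f 6 ^ 2 * f 7 * f 9
     - 144 * f 3 * f 4 * f 5 * f 8 ^ 2 * f 9 + 48 * f 3 * f 4 * f 5 * f 6 * f 7 * f 8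
     + 96 * f 3 * f 4 ^ 2 * f 6 ^ 2 * f 8 + 48 * f 3 ^ 2 * f 8 ^ 2 * f 9 ^ 2
     - 144 * f 3 ^ 2 * f 6 * f 7 * f 8 * f 9 + 216 * f 3 ^ 2 * f 6 ^ 2 * f 7 ^ 2
     + 96 * f 3 ^ 2 * f 5 * f 7 * f 8 ^ 2 + 96 * f 3 ^ 2 * f 4 * f 6 * f 8 ^ 2
     - 64 * f 3 ^ 3 * f 8 ^ 3 - 72 * f 2 * f 4 * f 5 ^ 2 * f 9 ^ 2
     + 288 * f 2 * f 4 * f 5 ^ 3 * f 7 - 576 * f 2 * f 4 ^ 2 * f 5 ^ 2 * f 6
     + 36 * f 2 * f 3 * f 5 * f 9 ^ 3 - 144 * f 2 * f 3 * f 5 ^ 2 * f 7 * f 9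
     + 720 * f 2 * f 3 * f 4 * f 5 * f 6 * f 9 - 144 * f 2 * f 3 * f 4 * f 5 ^ 2 * f 8
     - 72 * f 2 * f 3 ^ 2 * f 6 * f 9 ^ 2 - 144 * f 2 * f 3 ^ 2 * f 5 * f 8 * f 9
     - 144 * f 2 * f 3 ^ 2 * f 5 * f 6 * f 7 - 576 * f 2 * f 3 ^ 2 * f 4 * f 6 ^ 2
     + 288 * f 2 * f 3 ^ 3 * f 6 * f 8 + 216 * f 2 ^ 2 * f 3 ^ 2 * f 5 ^ 2
     + 36 * f 1 * f 4 * f 7 * f 9 ^ 3 - 144 * f 1 * f 4 * f 5 * f 7 ^ 2 * f 9
     - 72 * f 1 * f 4 ^ 2 * f 8 * f 9 ^ 2 - 144 * f 1 * f 4 ^ 2 * f 6 * f 7 * f 9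
     - 144 * f 1 * f 4 ^ 2 * f 5 * f 7 * f 8 + 288 * f 1 * f 4 ^ 3 * f 6 * f 8
     - 72 * f 1 * f 3 * f 7 ^ 2 * f 9 ^ 2 + 288 * f 1 * f 3 * f 5 * f 7 ^ 3
     + 720 * f 1 * f 3 * f 4 * f 7 * f 8 * f 9 - 144 * f 1 * f 3 * f 4 * f 6 * f 7 ^ 2
     - 576 * f 1 * f 3 * f 4 ^ 2 * f 8 ^ 2 - 576 * f 1 * f 3 ^ 2 * f 7 ^ 2 * f 8
     + 864 * f 1 * f 2 * f 4 ^ 2 * f 5 * f 9 - 648 * f 1 * f 2 * f 3 * f 4 * f 9 ^ 2
     - 1296 * f 1 * f 2 * f 3 * f 4 * f 5 * f 7 + 864 * f 1 * f 2 * f 3 * f 4 ^ 2 * f 6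
     + 864 * f 1 * f 2 * f 3 ^ 2 * f 7 * f 9 + 864 * f 1 * f 2 * f 3 ^ 2 * f 4 * f 8
     - 864 * f 1 * f 2 ^ 2 * f 3 ^ 3 + 216 * f 1 ^ 2 * f 4 ^ 2 * f 7 ^ 2
     - 864 * f 1 ^ 2 * f 2 * f 4 ^ 3 + 36 * f 0 * f 6 * f 8 * f 9 ^ 3
     - 72 * f 0 * f 6 ^ 2 * f 7 * f 9 ^ 2 - 72 * f 0 * f 5 * f 8 ^ 2 * f 9 ^ 2
     + 720 * f 0 * f 5 * f 6 * f 7 * f 8 * f 9 - 576 * f 0 * f 5 * f 6 ^ 2 * f 7 ^ 2
     - 576 * f 0 * f 5 ^ 2 * f 7 * f 8 ^ 2 - 144 * f 0 * f 4 * f 6 ^ 2 * f 8 * f 9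
     + 288 * f 0 * f 4 * f 6 ^ 3 * f 7 - 144 * f 0 * f 4 * f 5 * f 6 * f 8 ^ 2
     - 144 * f 0 * f 3 * f 6 * f 8 ^ 2 * f 9 - 144 * f 0 * f 3 * f 6 ^ 2 * f 7 * f 8
     + 288 * f 0 * f 3 * f 5 * f 8 ^ 3 - 648 * f 0 * f 2 * f 5 * f 6 * f 9 ^ 2
     + 864 * f 0 * f 2 * f 5 ^ 2 * f 8 * f 9 + 864 * f 0 * f 2 * f 5 ^ 2 * f 6 * f 7
     + 864 * f 0 * f 2 * f 4 * f 5 * f 6 ^ 2 + 864 * f 0 * f 2 * f 3 * f 6 ^ 2 * f 9
     - 1296 * f 0 * f 2 * f 3 * f 5 * f 6 * f 8 - 864 * f 0 * f 2 ^ 2 * f 5 ^ 3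
     - 648 * f 0 * f 1 * f 7 * f 8 * f 9 ^ 2 + 864 * f 0 * f 1 * f 6 * f 7 ^ 2 * f 9
     + 864 * f 0 * f 1 * f 5 * f 7 ^ 2 * f 8 + 864 * f 0 * f 1 * f 4 * f 8 ^ 2 * f 9
     - 1296 * f 0 * f 1 * f 4 * f 6 * f 7 * f 8 + 864 * f 0 * f 1 * f 3 * f 7 * f 8 ^ 2
     + 540 * f 0 * f 1 * f 2 * f 9 ^ 3 - 1296 * f 0 * f 1 * f 2 * f 5 * f 7 * f 9
     - 1296 * f 0 * f 1 * f 2 * f 4 * f 6 * f 9 - 1296 * f 0 * f 1 * f 2 * f 4 * f 5 * f 8
     - 1296 * f 0 * f 1 * f 2 * f 3 * f 8 * f 9 - 1296 * f 0 * f 1 * f 2 * f 3 * f 6 * f 7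
     + 3888 * f 0 * f 1 * f 2 ^ 2 * f 3 * f 5 - 864 * f 0 * f 1 ^ 2 * f 7 ^ 3
     + 3888 * f 0 * f 1 ^ 2 * f 2 * f 4 * f 7 + 216 * f 0 ^ 2 * f 6 ^ 2 * f 8 ^ 2
     - 864 * f 0 ^ 2 * f 2 * f 6 ^ 3 - 864 * f 0 ^ 2 * f 1 * f 8 ^ 3
     + 3888 * f 0 ^ 2 * f 1 * f 2 * f 6 * f 8 - 5832 * f 0 ^ 2 * f 1 ^ 2 * f 2 ^ 2"

lemma cubic_value_eq_imp_coeffs_eq:
  assumes eq: "\<And>x y z. cubic_value f x y z = cubic_value g x y z" and "i < 10"
  shows "f i = g i"
proof -
  have 0: "f 0 = g 0" using eq[of 1 0 0] by (simp add: cubic_value_def)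
  have 1: "f 1 = g 1" using eq[of 0 1 0] by (simp add: cubic_value_def)
  have 2: "f 2 = g 2" using eq[of 0 0 1] by (simp add: cubic_value_def)
  have 35: "f 3 = g 3 \<and> f 5 = g 5" using eq[of 1 1 0] eq[of 1 "-1" 0] 0 1
    by (simp add: cubic_value_def) algebra
  have 47: "f 4 = g 4 \<and> f 7 = g 7" using eq[of 1 0 1] eq[of 1 0 "-1"] 0 2
    by (simp add: cubic_value_def) algebra
  have 68: "f 6 = g 6 \<and> f 8 = g 8" using eq[of 0 1 1] eq[of 0 1 "-1"] 1 2
    by (simp add: cubic_value_def) algebra
  have 9: "f 9 = g 9" using eq[of 1 1 1] 0 1 2 35 47 68 by (simp add: cubic_value_def)
  have "i \<in> {0, 1, 2, 3, 4, 5, 6, 7, 8, 9}" using \<open>i < 10\<close> by auto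
  then show ?thesis using 0 1 2 35 47 68 9 by auto
qed

type_synonym vec3 = "complex \<times> complex \<times> complex"

fun cubic_eval :: "(nat \<Rightarrow> complex) \<Rightarrow> vec3 \<Rightarrow> complex" where
  "cubic_eval f (x, y, z) = cubic_value f x y z"

text \<open>The derivative of the cubic at the first point in the direction of the second.\<close>

fun polar :: "(nat \<Rightarrow> complex) \<Rightarrow> vec3 \<Rightarrow> vec3 \<Rightarrow> complex" where
  "polar f (x, y, z) (u, v, w) =
     (3 * f 0 * x^2 + 2 * f 3 * x * y + 2 * f 4 * x * z + f 5 * y^2 + f 7 * z^2 + f 9 * y * z) * u
   + (3 * f 1 * y^2 + f 3 * x^2 + 2 * f 5 * x * y + 2 * f 6 * y * z + f 8 * z^2 + f 9 * x * z) * v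
   + (3 * f 2 * z^2 + f 4 * x^2 + f 6 * y^2 + 2 * f 7 * x * z + 2 * f 8 * y * z + f 9 * x * y) * w"

text \<open>The second derivative of the cubic at the first point as a bilinear form, that is, up to the factor
6 the symmetric trilinear form with the cubic as its diagonal.\<close>

fun polar3 :: "(nat \<Rightarrow> complex) \<Rightarrow> vec3 \<Rightarrow> vec3 \<Rightarrow> vec3 \<Rightarrow> complex" where
  "polar3 f (x, y, z) (u, v, w) (a, b, c) =
     (6 * f 0 * x * a + 2 * f 3 * (x * b + a * y) + 2 * f 4 * (x * c + a * z) + 2 * f 5 * y * b + 2 * f 7 * z * c + f 9 * (y * c + b * z)) * u
   + (6 * f 1 * y * b + 2 * f 3 * x * a + 2 * f 5 * (x * b + a * y) + 2 * f 6 * (y * c + b * z) + 2 * f 8 * z * c + f 9 * (x * c + a * z)) * v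
   + (6 * f 2 * z * c + 2 * f 4 * x * a + 2 * f 6 * y * b + 2 * f 7 * (x * c + a * z) + 2 * f 8 * (y * c + b * z) + f 9 * (x * b + a * y)) * w"

text \<open>The coefficients of the cubic after the substitution whose matrix has the columns \<open>p\<close>, \<open>q\<close>, \<open>r\<close>
(see \<open>cubic_eval_lincomb\<close>).\<close>

definition pullback :: "(nat \<Rightarrow> complex) \<Rightarrow> vec3 \<Rightarrow> vec3 \<Rightarrow> vec3 \<Rightarrow> nat \<Rightarrow> complex" where
  "pullback f p q r = (!) [cubic_eval f p, cubic_eval f q, cubic_eval f r, polar f p q, polar f p r, polar f q p,
      polar f q r, polar f r p, polar f r q, polar3 f p q r]"

fun lincomb :: "vec3 \<Rightarrow> vec3 \<Rightarrow> vec3 \<Rightarrow> vec3 \<Rightarrow> vec3" where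
  "lincomb (p1, p2, p3) (q1, q2, q3) (r1, r2, r3) (x, y, z) =
     (p1 * x + q1 * y + r1 * z, p2 * x + q2 * y + r2 * z, p3 * x + q3 * y + r3 * z)"

fun det3 :: "vec3 \<Rightarrow> vec3 \<Rightarrow> vec3 \<Rightarrow> complex" where
  "det3 (p1, p2, p3) (q1, q2, q3) (r1, r2, r3) =
     p1 * (q2 * r3 - q3 * r2) - q1 * (p2 * r3 - p3 * r2) + r1 * (p2 * q3 - p3 * q2)"

lemma cubic_eval_lincomb: "cubic_eval f (lincomb p q r v) = cubic_eval (pullback f p q r) v"
proof -
  obtain p1 p2 p3 q1 q2 q3 r1 r2 r3 x y z where
    [simp]: "p = (p1, p2, p3)" "q = (q1, q2, q3)" "r = (r1, r2, r3)" "v = (x, y, z)"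
    by (metis prod.exhaust)
  show ?thesis
    apply (simp add: pullback_def cubic_value_def)
    by algebra
qed

lemma nth10:
  "([a, b, c, d, e, f, g, h, i, j] :: 'a list) ! 0 = a" "[a, b, c, d, e, f, g, h, i, j] ! 1 = b"
  "[a, b, c, d, e, f, g, h, i, j] ! 2 = c" "[a, b, c, d, e, f, g, h, i, j] ! 3 = d"
  "[a, b, c, d, e, f, g, h, i, j] ! 4 = e" "[a, b, c, d, e, f, g, h, i, j] ! 5 = f"
  "[a, b, c, d, e, f, g, h, i, j] ! 6 = g" "[a, b, c, d, e, f, g, h, i, j] ! 7 = h"
  "[a, b, c, d, e, f, g, h, i, j] ! 8 = i" "[a, b, c, d, e, f, g, h, i, j] ! 9 = j"
  by simp_all

lemma pullback_shear:
  "pullback f (1, 0, 0) (t, 1, 0) (0, 0, 1) = (!)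
     [f 0, f 1 + t * f 5 + t^2 * f 3 + t^3 * f 0, f 2, f 3 + 3 * t * f 0, f 4,
      f 5 + 2 * t * f 3 + 3 * t^2 * f 0, f 6 + t * f 9 + t^2 * f 4, f 7, f 8 + t * f 7, f 9 + 2 * t * f 4]"
  unfolding pullback_def by (simp add: cubic_value_def algebra_simps)

lemma pullback_swap12:
  "pullback f (0, 1, 0) (1, 0, 0) (0, 0, 1) = (!) [f 1, f 0, f 2, f 5, f 6, f 3, f 4, f 8, f 7, f 9]"
  unfolding pullback_def by (simp add: cubic_value_def)

lemma pullback_swap23:
  "pullback f (1, 0, 0) (0, 0, 1) (0, 1, 0) = (!) [f 0, f 2, f 1, f 4, f 3, f 7, f 8, f 5, f 6, f 9]"
  unfolding pullback_def by (simp add: cubic_value_def)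

lemma pullback_diag:
  "pullback f (a, 0, 0) (0, b, 0) (0, 0, c) = (!)
     [a^3 * f 0, b^3 * f 1, c^3 * f 2, a^2 * b * f 3, a^2 * c * f 4, a * b^2 * f 5, b^2 * c * f 6,
      a * c^2 * f 7, b * c^2 * f 8, a * b * c * f 9]"
  unfolding pullback_def by (simp add: cubic_value_def algebra_simps)

lemma cubic_S_shear: "cubic_S (pullback f (1, 0, 0) (t, 1, 0) (0, 0, 1)) = cubic_S f"
  unfolding cubic_S_def pullback_shear nth10 by algebra

lemma cubic_T_shear: "cubic_T (pullback f (1, 0, 0) (t, 1, 0) (0, 0, 1)) = cubic_T f"
  unfolding cubic_T_def pullback_shear nth10 by algebra

lemma cubic_S_swap12: "cubic_S (pullback f (0, 1, 0) (1, 0, 0) (0, 0, 1)) = cubic_S f"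
  unfolding cubic_S_def pullback_swap12 nth10 by algebra

lemma cubic_T_swap12: "cubic_T (pullback f (0, 1, 0) (1, 0, 0) (0, 0, 1)) = cubic_T f"
  unfolding cubic_T_def pullback_swap12 nth10 by algebra

lemma cubic_S_swap23: "cubic_S (pullback f (1, 0, 0) (0, 0, 1) (0, 1, 0)) = cubic_S f"
  unfolding cubic_S_def pullback_swap23 nth10 by algebra

lemma cubic_T_swap23: "cubic_T (pullback f (1, 0, 0) (0, 0, 1) (0, 1, 0)) = cubic_T f"
  unfolding cubic_T_def pullback_swap23 nth10 by algebra

lemma cubic_S_diag: "cubic_S (pullback f (a, 0, 0) (0, b, 0) (0, 0, c)) = (a * b * c) ^ 4 * cubic_S f"
  unfolding cubic_S_def pullback_diag nth10 by algebra

lemma cubic_T_diag: "cubic_T (pullback f (a, 0, 0) (0, b, 0) (0, 0, c)) = (a * b * c) ^ 6 * cubic_T f"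
  unfolding cubic_T_def pullback_diag nth10 by algebra

section \<open>Behaviour of the invariants under linear substitutions\<close>

text \<open>The columns \<open>p\<close>, \<open>q\<close>, \<open>r\<close> form a matrix for which the two invariants behave as invariants of degree 4
and 6 of ternary cubics have to. This property passes to products, so that it is enough to have it for
swaps, shears and diagonal matrices, where it is a polynomial identity in the ten coefficients and the parameters of the matrix.\<close>

definition covariant :: "vec3 \<Rightarrow> vec3 \<Rightarrow> vec3 \<Rightarrow> bool" where
  "covariant p q r \<longleftrightarrow>
     (\<forall>f. cubic_S (pullback f p q r) = det3 p q r ^ 4 * cubic_S f \<and>
          cubic_T (pullback f p q r) = det3 p q r ^ 6 * cubic_T f)"

lemma cubic_S_cong: "(\<And>i. i < 10 \<Longrightarrow> f i = g i) \<Longrightarrow> cubic_S f = cubic_S g"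
  by (simp add: cubic_S_def)

lemma cubic_T_cong: "(\<And>i. i < 10 \<Longrightarrow> f i = g i) \<Longrightarrow> cubic_T f = cubic_T g"
  by (simp add: cubic_T_def)

lemma cubic_eval_eq_imp_coeffs_eq: "(\<And>v. cubic_eval f v = cubic_eval g v) \<Longrightarrow> i < 10 \<Longrightarrow> f i = g i"
  by (rule cubic_value_eq_imp_coeffs_eq) (metis cubic_eval.simps)

lemma lincomb_lincomb:
  "lincomb p q r (lincomb a b c v) = lincomb (lincomb p q r a) (lincomb p q r b) (lincomb p q r c) v"
proof -
  obtain p1 p2 p3 q1 q2 q3 r1 r2 r3 a1 a2 a3 b1 b2 b3 c1 c2 c3 x y z where
    "p = (p1, p2, p3)" "q = (q1, q2, q3)" "r = (r1, r2, r3)"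
    "a = (a1, a2, a3)" "b = (b1, b2, b3)" "c = (c1, c2, c3)" "v = (x, y, z)"
    by (metis prod.exhaust)
  then show ?thesis by (simp add: algebra_simps)
qed

lemma det3_lincomb:
  "det3 (lincomb p q r a) (lincomb p q r b) (lincomb p q r c) = det3 p q r * det3 a b c"
proof -
  obtain p1 p2 p3 q1 q2 q3 r1 r2 r3 a1 a2 a3 b1 b2 b3 c1 c2 c3 where
    e: "p = (p1, p2, p3)" "q = (q1, q2, q3)" "r = (r1, r2, r3)"
    "a = (a1, a2, a3)" "b = (b1, b2, b3)" "c = (c1, c2, c3)"
    by (metis prod.exhaust)
  show ?thesis unfolding e lincomb.simps det3.simps by algebra
qed

lemma covariant_compose:
  assumes "covariant p q r" "covariant a b c"
  shows "covariant (lincomb p q r a) (lincomb p q r b) (lincomb p q r c)"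
proof -
  have eq: "pullback f (lincomb p q r a) (lincomb p q r b) (lincomb p q r c) i = pullback (pullback f p q r) a b c i"
    if "i < 10" for f i
    by (rule cubic_eval_eq_imp_coeffs_eq[OF _ that]) (simp only: cubic_eval_lincomb[symmetric] lincomb_lincomb)
  have "cubic_S (pullback f (lincomb p q r a) (lincomb p q r b) (lincomb p q r c))
          = cubic_S (pullback (pullback f p q r) a b c)"
       "cubic_T (pullback f (lincomb p q r a) (lincomb p q r b) (lincomb p q r c))
          = cubic_T (pullback (pullback f p q r) a b c)" for f
    by (rule cubic_S_cong cubic_T_cong, erule eq)+
  then show ?thesis
    using assms unfolding covariant_def det3_lincomb
    by (simp add: power_mult_distrib mult_ac)
qed

lemma covariant_shear: "covariant (1, 0, 0) (t, 1, 0) (0, 0, 1)"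
  by (simp add: covariant_def cubic_S_shear cubic_T_shear)

lemma covariant_swap12: "covariant (0, 1, 0) (1, 0, 0) (0, 0, 1)"
  by (simp add: covariant_def cubic_S_swap12 cubic_T_swap12)

lemma covariant_swap23: "covariant (1, 0, 0) (0, 0, 1) (0, 1, 0)"
  by (simp add: covariant_def cubic_S_swap23 cubic_T_swap23)

lemma covariant_diag: "covariant (a, 0, 0) (0, b, 0) (0, 0, c)"
  by (simp add: covariant_def cubic_S_diag cubic_T_diag mult.assoc)

lemma covariant_swap_columns:
  assumes "covariant p q r" shows "covariant q p r" "covariant p r q"
proof -
  obtain p1 p2 p3 q1 q2 q3 r1 r2 r3 where
    "p = (p1, p2, p3)" "q = (q1, q2, q3)" "r = (r1, r2, r3)"
    by (metis prod.exhaust)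
  then show "covariant q p r" "covariant p r q"
    using covariant_compose[OF assms covariant_swap12] covariant_compose[OF assms covariant_swap23] by simp_all
qed

fun axpy :: "complex \<Rightarrow> vec3 \<Rightarrow> vec3 \<Rightarrow> vec3" where
  "axpy t (x, y, z) (u, v, w) = (t * x + u, t * y + v, t * z + w)"

lemma covariant_add_column:
  assumes "covariant p q r" shows "covariant p (axpy t p q) r"
proof -
  obtain p1 p2 p3 q1 q2 q3 r1 r2 r3 where
    "p = (p1, p2, p3)" "q = (q1, q2, q3)" "r = (r1, r2, r3)"
    by (metis prod.exhaust)
  then show ?thesis
    using covariant_compose[OF assms covariant_shear[of t]] by (simp add: algebra_simps)
qed

lemma covariant_add_column_iff: "covariant p (axpy t p q) r \<longleftrightarrow> covariant p q r"
proof
  assume "covariant p (axpy t p q) r"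
  then have "covariant p (axpy (- t) p (axpy t p q)) r" by (rule covariant_add_column)
  then show "covariant p q r" by (cases p; cases q) simp
qed (rule covariant_add_column)

lemma covariant_swap_columns_iff:
  "covariant q p r \<longleftrightarrow> covariant p q r" "covariant p r q \<longleftrightarrow> covariant p q r"
  using covariant_swap_columns by blast+

lemma covariant_add_other_columns_iff:
  "covariant p q (axpy t p r) \<longleftrightarrow> covariant p q r"
  "covariant p q (axpy t q r) \<longleftrightarrow> covariant p q r"
  "covariant (axpy t q p) q r \<longleftrightarrow> covariant p q r"
  "covariant (axpy t r p) q r \<longleftrightarrow> covariant p q r"
  "covariant p (axpy t r q) r \<longleftrightarrow> covariant p q r"
  by (metis covariant_add_column_iff covariant_swap_columns_iff)+

lemma covariant_triangular:
  assumes "d \<noteq> 0" "g \<noteq> 0"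
  shows "covariant (a, b, c) (0, d, e) (0, 0, g)"
proof -
  have "covariant (a, 0, 0) (0, d, 0) (0, 0, g)" by (rule covariant_diag)
  then have "covariant (axpy (c / g) (0, 0, g) (axpy (b / d) (0, d, 0) (a, 0, 0))) (axpy (e / g) (0, 0, g) (0, d, 0)) (0, 0, g)"
    by (simp only: covariant_add_other_columns_iff)
  then show ?thesis using assms by simp
qed

text \<open>Elimination by column operations: pivots in the first and in the second row leave a lower triangular
matrix.\<close>

theorem covariant_if_det_nonzero:
  assumes "det3 p q r \<noteq> 0" shows "covariant p q r"
proof -
  have pivot2: "covariant (a, b, c) (0, d, e) (0, f, g)"
    if det: "det3 (a, b, c) (0, d, e) (0, f, g) \<noteq> 0" and "d \<noteq> 0" for a b c d e f g
  proof -
    have "axpy (- f / d) (0, d, e) (0, f, g) = (0, 0, (d * g - e * f) / d)"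
      using \<open>d \<noteq> 0\<close> by (simp add: field_simps)
    moreover have "d * g - e * f \<noteq> 0" using det by (auto simp: algebra_simps)
    ultimately have "covariant (a, b, c) (0, d, e) (axpy (- f / d) (0, d, e) (0, f, g))"
      using \<open>d \<noteq> 0\<close> by (simp only:) (rule covariant_triangular, auto)
    then show ?thesis by (simp only: covariant_add_other_columns_iff)
  qed
  have pivot2': "covariant (a, b, c) (0, d, e) (0, f, g)"
    if det: "det3 (a, b, c) (0, d, e) (0, f, g) \<noteq> 0" for a b c d e f g
  proof (cases "d = 0")
    case True
    then have "covariant (a, b, c) (0, f, g) (0, d, e)"
      using det by (intro pivot2) auto
    then show ?thesis by (simp only: covariant_swap_columns_iff)
  qed (use pivot2 det in blast)
  have pivot1: "covariant p q r" if det: "det3 p q r \<noteq> 0" and "fst p \<noteq> 0" for p q r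
  proof -
    obtain a b c d e f g h i where e: "p = (a, b, c)" "q = (d, e, f)" "r = (g, h, i)"
      by (metis prod.exhaust)
    have "a \<noteq> 0" using that e by simp
    have "axpy (- d / a) p q = (0, e - d * b / a, f - d * c / a)" "axpy (- g / a) p r = (0, h - g * b / a, i - g * c / a)"
      using \<open>a \<noteq> 0\<close> by (simp_all add: e)
    moreover have "det3 p (axpy (- d / a) p q) (axpy (- g / a) p r) = det3 p q r"
      using \<open>a \<noteq> 0\<close> by (simp add: e field_simps)
    ultimately have "covariant p (axpy (- d / a) p q) (axpy (- g / a) p r)"
      using det by (simp only: e) (rule pivot2', simp)
    then show ?thesis by (simp only: covariant_add_column_iff covariant_add_other_columns_iff)
  qed
  have "fst p \<noteq> 0 \<or> fst q \<noteq> 0 \<or> fst r \<noteq> 0"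
    using assms by (cases p; cases q; cases r) auto
  then consider "fst p \<noteq> 0" | "fst q \<noteq> 0" | "fst r \<noteq> 0" by blast
  then show ?thesis
  proof cases
    case 1
    then show ?thesis using pivot1 assms by blast
  next
    case 2
    have "det3 q p r \<noteq> 0" using assms by (cases p; cases q; cases r) (auto simp: algebra_simps)
    with 2 pivot1 have "covariant q p r" by blast
    then show ?thesis by (simp only: covariant_swap_columns_iff)
  next
    case 3
    have "det3 r q p \<noteq> 0" using assms by (cases p; cases q; cases r) (auto simp: algebra_simps)
    with 3 pivot1 have "covariant r q p" by blast
    then show ?thesis using covariant_swap_columns by blast
  qed
qed

section \<open>Linear algebra of triples\<close>

definition mat3 :: "vec3 \<Rightarrow> vec3 \<Rightarrow> vec3 \<Rightarrow> complex^3^3" where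
  "mat3 p q r = transpose (vector [vector [fst p, fst (snd p), snd (snd p)],
      vector [fst q, fst (snd q), snd (snd q)], vector [fst r, fst (snd r), snd (snd r)]])"

definition triple :: "complex^3 \<Rightarrow> vec3" where
  "triple v = (v $ 1, v $ 2, v $ 3)"

lemma det_mat3: "det (mat3 p q r) = det3 p q r"
  unfolding mat3_def det_transpose by (cases p; cases q; cases r) (simp add: det_3 algebra_simps)

lemma triple_mat3: "triple (mat3 p q r *v v) = lincomb p q r (triple v)"
  by (cases p; cases q; cases r)
     (simp add: mat3_def triple_def matrix_vector_mult_def sum_3 transpose_def)

lemma mat3_surj: "\<exists>p q r. M = mat3 p q r"
  by (intro exI[of _ "triple (column 1 M)"] exI[of _ "triple (column 2 M)"] exI[of _ "triple (column 3 M)"])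
     (simp add: mat3_def triple_def vec_eq_iff forall_3 transpose_def column_def)

lemma triple_surj: "\<exists>v. w = triple v"
  by (cases w) (auto intro!: exI[of _ "vector [_, _, _]"] simp: triple_def)

lemma triple_eq_0_iff: "triple v = (0, 0, 0) \<longleftrightarrow> v = 0"
  by (simp add: triple_def vec_eq_iff forall_3)

lemma det3_zero_imp_kernel:
  assumes "det3 p q r = 0"
  obtains w where "w \<noteq> (0, 0, 0)" "lincomb p q r w = (0, 0, 0)"
proof -
  have "\<not> invertible (mat3 p q r)" using assms by (simp add: invertible_det_nz det_mat3)
  then obtain v where v: "mat3 p q r *v v = 0" "v \<noteq> 0"
    using matrix_left_invertible_ker[of "mat3 p q r"] by (auto simp: invertible_left_inverse)
  have "lincomb p q r (triple v) = triple 0" by (simp only: v(1) flip: triple_mat3)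
  with v(2) show ?thesis using that[of "triple v"] by (simp add: triple_eq_0_iff)
qed

lemma complete_basis:
  assumes "p \<noteq> (0, 0, 0)"
  obtains q r where "det3 q r p \<noteq> 0"
proof -
  obtain a b c where p: "p = (a, b, c)" by (metis prod.exhaust)
  consider "a \<noteq> 0" | "b \<noteq> 0" | "c \<noteq> 0" using assms p by auto
  then show ?thesis
  proof cases
    case 1 then show ?thesis using that[of "(0, 1, 0)" "(0, 0, 1)"] by (simp add: p)
  next
    case 2 then show ?thesis using that[of "(1, 0, 0)" "(0, 0, 1)"] by (simp add: p)
  next
    case 3 then show ?thesis using that[of "(1, 0, 0)" "(0, 1, 0)"] by (simp add: p)
  qed
qed

section \<open>Singular cubics\<close>

lemma polar_self: "polar f p p = 3 * cubic_eval f p"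
proof -
  obtain x y z where p: "p = (x, y, z)" by (metis prod.exhaust)
  show ?thesis unfolding p polar.simps cubic_eval.simps cubic_value_def by algebra
qed

lemmas drop_zeros = mult_zero_left mult_zero_right power_zero_numeral diff_0_right add_0_right add_0_left

text \<open>Such a cubic is singular at \<open>(0:0:1)\<close>, with tangent cone \<open>f 4 * x\<^sup>2 + f 9 * x * y + f 6 * y\<^sup>2\<close>. The discriminant of this
quadratic form is a square root of \<open>S\<close> and a cube root of \<open>T\<close>.\<close>

lemma cubic_ST_singular_at_z:
  assumes "f 2 = 0" "f 7 = 0" "f 8 = 0"
  shows "cubic_S f ^ 3 = cubic_T f ^ 2"
proof -
  have "cubic_S f = (f 9 ^ 2 - 4 * f 4 * f 6) ^ 2" unfolding cubic_S_def assms drop_zeros by algebra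
  moreover have "cubic_T f = (f 9 ^ 2 - 4 * f 4 * f 6) ^ 3" unfolding cubic_T_def assms drop_zeros by algebra
  ultimately show ?thesis by (simp flip: power_mult)
qed

text \<open>The first three conditions make \<open>(0:1:0)\<close> a flex with tangent \<open>z = 0\<close>. Without \<open>x\<^sup>3\<close> this line is a
component of the cubic; without \<open>y\<^sup>2z\<close> the point is singular.\<close>

lemma cubic_ST_flex_degenerate:
  assumes "f 1 = 0" "f 3 = 0" "f 5 = 0" and "f 0 = 0 \<or> f 6 = 0"
  shows "cubic_S f ^ 3 = cubic_T f ^ 2"
proof -
  have "cubic_S f = (f 9 ^ 2 - 4 * f 4 * f 6) ^ 2 \<and> cubic_T f = (f 9 ^ 2 - 4 * f 4 * f 6) ^ 3"
    using assms(4)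
  proof
    assume z: "f 0 = 0"
    show ?thesis unfolding cubic_S_def cubic_T_def assms(1-3) z drop_zeros by (rule conjI; algebra)
  next
    assume z: "f 6 = 0"
    show ?thesis unfolding cubic_S_def cubic_T_def assms(1-3) z drop_zeros by (rule conjI; algebra)
  qed
  then show ?thesis by (simp flip: power_mult)
qed

text \<open>A substitution moves the singular point to \<open>(0:0:1)\<close>.\<close>

lemma singular_imp_invariants:
  assumes "p \<noteq> (0, 0, 0)" and "\<And>q. polar f p q = 0"
  shows "cubic_S f ^ 3 = cubic_T f ^ 2"
proof -
  obtain q r where det: "det3 q r p \<noteq> 0" using complete_basis[OF assms(1)] .
  let ?g = "pullback f q r p"
  have "cubic_eval f p = 0" using polar_self[of f p] assms(2) by simp
  then have "?g 2 = 0" "?g 7 = 0" "?g 8 = 0" using assms(2) by (simp_all add: pullback_def)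
  then have "cubic_S ?g ^ 3 = cubic_T ?g ^ 2" by (rule cubic_ST_singular_at_z)
  moreover have "cubic_S ?g = det3 q r p ^ 4 * cubic_S f" "cubic_T ?g = det3 q r p ^ 6 * cubic_T f"
    using covariant_if_det_nonzero[OF det] by (auto simp: covariant_def)
  ultimately have "det3 q r p ^ 12 * cubic_S f ^ 3 = det3 q r p ^ 12 * cubic_T f ^ 2"
    by (simp add: power_mult_distrib flip: power_mult)
  with det show ?thesis by simp
qed

section \<open>Linear equivalence of cubics\<close>

definition equivalent :: "(nat \<Rightarrow> complex) \<Rightarrow> (nat \<Rightarrow> complex) \<Rightarrow> bool" where
  "equivalent f g \<longleftrightarrow>
     (\<exists>p q r k. det3 p q r \<noteq> 0 \<and> k \<noteq> 0 \<and> (\<forall>v. cubic_eval f (lincomb p q r v) = k * cubic_eval g v))"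

lemma equivalent_trans:
  assumes "equivalent f g" "equivalent g h"
  shows "equivalent f h"
proof -
  obtain p q r k where 1: "det3 p q r \<noteq> 0" "k \<noteq> 0" "\<And>v. cubic_eval f (lincomb p q r v) = k * cubic_eval g v"
    using assms(1) by (auto simp: equivalent_def)
  obtain a b c l where 2: "det3 a b c \<noteq> 0" "l \<noteq> 0" "\<And>v. cubic_eval g (lincomb a b c v) = l * cubic_eval h v"
    using assms(2) by (auto simp: equivalent_def)
  have "cubic_eval f (lincomb (lincomb p q r a) (lincomb p q r b) (lincomb p q r c) v) = (k * l) * cubic_eval h v" for v
    by (simp add: 1(3) 2(3) flip: lincomb_lincomb)
  moreover have "det3 (lincomb p q r a) (lincomb p q r b) (lincomb p q r c) \<noteq> 0" "k * l \<noteq> 0"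
    using 1 2 by (simp_all add: det3_lincomb)
  ultimately show ?thesis unfolding equivalent_def by blast
qed

lemma cubic_eval_scale: "cubic_eval (\<lambda>i. k * f i) v = k * cubic_eval f v"
  by (cases v) (simp add: cubic_value_def algebra_simps)

lemma equivalent_pullback:
  assumes "det3 p q r \<noteq> 0" "k \<noteq> 0" "\<forall>i<10. pullback f p q r i = k * g i"
  shows "equivalent f g"
proof -
  have "cubic_eval f (lincomb p q r v) = k * cubic_eval g v" for v
    by (cases v) (simp add: cubic_eval_lincomb cubic_value_def assms(3) algebra_simps)
  with assms show ?thesis unfolding equivalent_def by blast
qed

lemma equivalent_imp_invariants:
  assumes "equivalent f g"
  obtains d k where "d \<noteq> 0" "k \<noteq> 0" "k ^ 4 * cubic_S g = d ^ 4 * cubic_S f" "k ^ 6 * cubic_T g = d ^ 6 * cubic_T f"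
proof -
  obtain p q r k where *: "det3 p q r \<noteq> 0" "k \<noteq> 0" "\<And>v. cubic_eval f (lincomb p q r v) = k * cubic_eval g v"
    using assms by (auto simp: equivalent_def)
  have eq: "pullback f p q r i = k * g i" if "i < 10" for i
    using cubic_eval_eq_imp_coeffs_eq[of "pullback f p q r" "\<lambda>i. k * g i", OF _ that]
    by (simp add: cubic_eval_scale *(3) flip: cubic_eval_lincomb)
  have "cubic_S (pullback f p q r) = cubic_S (\<lambda>i. k * g i)" "cubic_T (pullback f p q r) = cubic_T (\<lambda>i. k * g i)"
    by (rule cubic_S_cong cubic_T_cong, erule eq)+
  moreover have "cubic_S (\<lambda>i. k * g i) = k ^ 4 * cubic_S g" unfolding cubic_S_def by algebra
  moreover have "cubic_T (\<lambda>i. k * g i) = k ^ 6 * cubic_T g" unfolding cubic_T_def by algebra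
  ultimately show ?thesis
    using that[OF *(1,2)] covariant_if_det_nonzero[OF *(1)] by (auto simp: covariant_def)
qed

lemma equivalent_nonsingular:
  assumes "equivalent f g" "cubic_S f ^ 3 \<noteq> cubic_T f ^ 2"
  shows "cubic_S g ^ 3 \<noteq> cubic_T g ^ 2"
proof
  assume eq: "cubic_S g ^ 3 = cubic_T g ^ 2"
  obtain d k where *: "d \<noteq> 0" "k \<noteq> 0" "k ^ 4 * cubic_S g = d ^ 4 * cubic_S f" "k ^ 6 * cubic_T g = d ^ 6 * cubic_T f"
    using equivalent_imp_invariants[OF assms(1)] .
  have "(d ^ 4 * cubic_S f) ^ 3 = (d ^ 6 * cubic_T f) ^ 2"
    unfolding *(3,4)[symmetric] power_mult_distrib eq by (simp flip: power_mult)
  then have "d ^ 12 * cubic_S f ^ 3 = d ^ 12 * cubic_T f ^ 2"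
    by (simp add: power_mult_distrib flip: power_mult)
  with * assms(2) show False by simp
qed

section \<open>Weierstrass form from a flex\<close>

definition weierstrass_coeffs :: "complex \<Rightarrow> complex \<Rightarrow> nat \<Rightarrow> complex" where
  "weierstrass_coeffs A B = (!) [- 1, 0, - B, 0, 0, 0, 1, - A, 0, 0]"

text \<open>The line through \<open>p\<close> and \<open>w\<close> touches the cubic at \<open>p\<close> to the third order: the restriction of the cubic
to \<open>s p + t w\<close> is a multiple of \<open>t\<^sup>3\<close>. The third vector only serves to express that \<open>p\<close> and \<open>w\<close> are
independent.\<close>

definition has_flex :: "(nat \<Rightarrow> complex) \<Rightarrow> bool" where
  "has_flex f \<longleftrightarrow> (\<exists>p w u. det3 w p u \<noteq> 0 \<and> cubic_eval f p = 0 \<and> polar f p w = 0 \<and> polar f w p = 0)"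

lemma all_less_10: "(\<forall>i<10. P i) \<longleftrightarrow> P 0 \<and> P 1 \<and> P 2 \<and> P 3 \<and> P 4 \<and> P 5 \<and> P 6 \<and> P 7 \<and> P 8 \<and> P (9::nat)"
  by (simp add: numeral_eq_Suc All_less_Suc conj_ac)

text \<open>The substitution with columns \<open>w\<close>, \<open>p\<close>, \<open>u\<close> moves the flex to \<open>(0:1:0)\<close> and its tangent to \<open>z = 0\<close>. What
remains is to complete a square in \<open>y\<close> and a cube in \<open>x\<close> and to scale \<open>z\<close>; no root has to be
extracted, since an overall factor is free.\<close>

lemma weierstrass_if_flex:
  assumes "has_flex f" and nonsing: "cubic_S f ^ 3 \<noteq> cubic_T f ^ 2"
  shows "\<exists>A B. equivalent f (weierstrass_coeffs A B)"
proof -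
  obtain p w u where flex: "det3 w p u \<noteq> 0" "cubic_eval f p = 0" "polar f p w = 0" "polar f w p = 0"
    using assms(1) by (auto simp: has_flex_def)
  define g where "g = pullback f w p u"
  have fg: "equivalent f g"
    by (rule equivalent_pullback[OF flex(1), of 1]) (simp_all add: g_def)
  have g0: "g 1 = 0" "g 3 = 0" "g 5 = 0" using flex by (simp_all add: g_def pullback_def)
  have nz: "g 0 \<noteq> 0 \<and> g 6 \<noteq> 0"
  proof (rule ccontr)
    assume "\<not> ?thesis"
    then have "g 0 = 0 \<or> g 6 = 0" by blast
    then have "cubic_S g ^ 3 = cubic_T g ^ 2" by (rule cubic_ST_flex_degenerate[OF g0(1,2,3)])
    with equivalent_nonsingular[OF fg nonsing] show False by simp
  qed
  \<comment> \<open>The column (1, a, 0) and the entry b complete the square in y, the entry e the cube in x.\<close>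
  define a where "a = - g 9 / (2 * g 6)"
  define e where "e = - (g 4 + a * g 9 + a^2 * g 6) / (3 * g 0)"
  define b where "b = - (g 8 + e * g 9) / (2 * g 6)"
  have a: "2 * g 6 * a = - g 9" and b: "2 * g 6 * b = - (g 8 + e * g 9)"
    and e: "3 * g 0 * e = - (g 4 + a * g 9 + a^2 * g 6)"
    using nz by (simp_all add: a_def b_def e_def)
  define h where "h = pullback g (1, a, 0) (0, 1, 0) (e, b, 1)"
  have gh: "equivalent g h"
    by (rule equivalent_pullback[of "(1, a, 0)" "(0, 1, 0)" "(e, b, 1)" 1]) (simp_all add: h_def)
  have "h 0 = g 0" "h 1 = 0" "h 3 = 0" "h 4 = 3 * g 0 * e + (g 4 + a * g 9 + a^2 * g 6)" "h 5 = 0"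
      "h 6 = g 6" "h 8 = 2 * g 6 * b + (g 8 + e * g 9)" "h 9 = 2 * g 6 * a + g 9"
    using g0 by (simp_all add: h_def pullback_def cubic_value_def algebra_simps)
  then have h: "h 0 = g 0" "h 1 = 0" "h 3 = 0" "h 4 = 0" "h 5 = 0" "h 6 = g 6" "h 8 = 0" "h 9 = 0"
    unfolding a b e by simp_all
  define m where "m = - g 0 / g 6"
  have m: "m \<noteq> 0" "g 6 * m = - g 0" using nz by (simp_all add: m_def)
  have "equivalent h (weierstrass_coeffs (m^2 * h 7 / g 0) (m^3 * h 2 / g 0))"
    by (rule equivalent_pullback[of "(1, 0, 0)" "(0, 1, 0)" "(0, 0, m)" "- g 0"])
       (use nz m h in \<open>simp_all add: all_less_10 pullback_def cubic_value_def weierstrass_coeffs_def\<close>)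
  with fg gh show ?thesis using equivalent_trans by blast
qed

section \<open>Existence of a flex\<close>

text \<open>The cubic \<open>y x\<^sup>2 + z\<^sup>2 x + c\<^sub>0 y\<^sup>3 + c\<^sub>1 y\<^sup>2 z + c\<^sub>2 y z\<^sup>2\<close>. It passes through \<open>(1:0:0)\<close> with tangent \<open>y = 0\<close>,
and \<open>(0:0:1)\<close> is the third intersection with this tangent.\<close>

definition nagell_coeffs :: "complex \<Rightarrow> complex \<Rightarrow> complex \<Rightarrow> nat \<Rightarrow> complex" where
  "nagell_coeffs c0 c1 c2 = (!) [0, c0, 0, 1, 0, 0, c1, 1, c2, 0]"

text \<open>\<open>H\<close> is one eighth of the Hessian determinant of \<open>F\<close>. In the chart \<open>z = 1\<close>, elimination of \<open>x\<close> from \<open>F\<close> and \<open>H\<close> gives,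
up to a power of \<open>y\<close>, the polynomial \<open>P\<close> of degree at most 9. Its constant term vanishes only if \<open>(0:0:1)\<close> is a flex,
its coefficient at \<open>y\<^sup>9\<close> only if there is a flex on the line \<open>z = 0\<close>. In the remaining case \<open>P\<close> has a
nonzero root.\<close>

lemma nagell_flex_point:
  fixes c0 c1 c2 :: complex
  defines "F \<equiv> \<lambda>x y z. y * x^2 + z^2 * x + c0 * y^3 + c1 * y^2 * z + c2 * y * z^2"
    and "H \<equiv> \<lambda>x y z. y * ((3 * c0 * y + c1 * z) * (x + c2 * y) - (c1 * y + c2 * z)^2)
        - x * (x * (x + c2 * y) - z * (c1 * y + c2 * z)) + z * (x * (c1 * y + c2 * z) - z * (3 * c0 * y + c1 * z))"
  shows "\<exists>x y z. (x, y, z) \<noteq> (0, 0, 0) \<and> F x y z = 0 \<and> H x y z = 0"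
proof (cases "c1 = 0")
  case True
  then have "F 0 0 1 = 0 \<and> H 0 0 1 = 0" by (simp add: F_def H_def)
  then show ?thesis by (intro exI[of _ 0] exI[of _ 1]) simp
next
  case c1: False
  let ?e = "16 * c0^2 * c2^2 - 8 * c0 * c1^2 * c2 + c1^4 + 16 * c0^3"
  define P where "P = [:- c1, - 3 * (c2^2 + c0), 0, 16 * c0 * c2 + 3 * c1^2 + 16 * c2^3,
      24 * c0 * c1 + 48 * c1 * c2^2, 24 * c0 * c2^2 + 54 * c1^2 * c2 + 24 * c0^2,
      64 * c0 * c1 * c2 + 24 * c1^3, 60 * c0 * c1^2, 48 * c0^2 * c1, ?e:]"
  show ?thesis
  proof (cases "degree P = 0")
    case True
    have "coeff P 9 = ?e" by (simp add: P_def eval_nat_numeral)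
    with True have e0: "?e = 0" by (metis coeff_eq_0 zero_less_numeral)
    have c0: "c0 \<noteq> 0" using e0 c1 by auto
    define x where "x = (c1^2 - 4 * c0 * c2) / (4 * c0)"
    have x: "4 * c0 * x = c1^2 - 4 * c0 * c2" using c0 by (simp add: x_def)
    \<comment> \<open>This x is forced by H(x, 1, 0) = 0 modulo x^2 = - c0, which is the equation F(x, 1, 0) = 0.\<close>
    have "16 * c0^2 * (x^2 + c0) = (4 * c0 * x)^2 + 16 * c0^3" by algebra
    also have "\<dots> = 0" unfolding x using e0 by algebra
    finally have sq: "x^2 = - c0" using c0 by (simp add: eq_neg_iff_add_eq_0)
    have "3 * c0 * (x + c2) - c1^2 - x * (x * (x + c2)) = 0" using sq x by algebra
    then have "F x 1 0 = 0 \<and> H x 1 0 = 0" by (simp add: F_def H_def sq)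
    then show ?thesis by (intro exI[of _ x] exI[of _ 1] exI[of _ 0]) simp
  next
    case False
    then obtain y where py: "poly P y = 0" using alg_closed_imp_poly_has_root[of P] by auto
    have y: "y \<noteq> 0"
    proof
      assume "y = 0"
      with py have "coeff P 0 = 0" by (simp add: poly_0_coeff_0)
      with c1 show False by (simp add: P_def)
    qed
    \<comment> \<open>With u = x y, the product y F is u^2 + u + y^2 q, and y^3 H is congruent to U + V u modulo y F.
        Elimination of u from these two gives the norm of U + V u.\<close>
    define q where "q = c0 * y^2 + c1 * y + c2"
    define U where "U = (4 * c0 * c2 - c1^2) * y^6 - 4 * c0 * y^4 - 2 * c1 * y^3 - c2 * y^2"
    define V where "V = 4 * c0 * y^4 + 4 * c1 * y^3 + 4 * c2 * y^2 - 1"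
    have norm: "U^2 - U * V + V^2 * (y^2 * q) = 0"
    proof -
      have "U^2 - U * V + V^2 * (y^2 * q) = y^3 * poly P y"
        unfolding U_def V_def q_def P_def poly_pCons poly_0 by algebra
      then show ?thesis unfolding py by simp
    qed
    obtain u where u: "u^2 + u + y^2 * q = 0" "U + V * u = 0"
    proof (cases "V = 0")
      case True
      with norm have "U = 0" by simp
      have "degree [:y^2 * q, 1, 1:] > 0" by simp
      from alg_closed_imp_poly_has_root[OF this] obtain u where "poly [:y^2 * q, 1, 1:] u = 0" by (rule exE)
      then have "u^2 + u + y^2 * q = 0" by (simp add: power2_eq_square algebra_simps)
      with True \<open>U = 0\<close> show ?thesis using that[of u] by simp
    next
      case False
      have "V^2 * ((- U / V)^2 + (- U / V) + y^2 * q) = U^2 - U * V + V^2 * (y^2 * q)"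
        using False by (simp add: field_simps power2_eq_square)
      with norm False have "(- U / V)^2 + (- U / V) + y^2 * q = 0" by simp
      then show ?thesis using that[of "- U / V"] False by simp
    qed
    define x where "x = u / y"
    have ux: "u = x * y" using y by (simp add: x_def)
    have "y * F x y 1 = u^2 + u + y^2 * q" unfolding F_def ux q_def power_one mult_1_left mult_1_right by algebra
    then have F0: "F x y 1 = 0" using u y by simp
    have "y^3 * H x y 1 = U + V * u + (1 - u - c2 * y^2) * (u^2 + u + y^2 * q)"
      unfolding H_def ux U_def V_def q_def power_one mult_1_left mult_1_right by algebra
    then have "H x y 1 = 0" using u y by simp
    with F0 show ?thesis by (intro exI[of _ x] exI[of _ y] exI[of _ 1]) simp
  qed
qed

lemma polar3_self: "polar3 f p p q = 2 * polar f p q"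
proof -
  obtain x y z a b c where p: "p = (x, y, z)" "q = (a, b, c)" by (metis prod.exhaust)
  show ?thesis unfolding p polar3.simps polar.simps by algebra
qed

lemma polar3_commute: "polar3 f p q r = polar3 f q p r" "polar3 f p q r = polar3 f p r q"
proof -
  obtain x y z a b c d e g where p: "p = (x, y, z)" "q = (a, b, c)" "r = (d, e, g)" by (metis prod.exhaust)
  show "polar3 f p q r = polar3 f q p r" "polar3 f p q r = polar3 f p r q"
    unfolding p polar3.simps by algebra+
qed

lemma polar_lincomb: "polar f p (lincomb q r s (x, y, z)) = x * polar f p q + y * polar f p r + z * polar f p s"
  by (cases p; cases q; cases r; cases s) (simp add: algebra_simps)

lemma polar3_lincomb: "polar3 f p q (lincomb r s t (x, y, z)) = x * polar3 f p q r + y * polar3 f p q s + z * polar3 f p q t"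
  by (cases p; cases q; cases r; cases s; cases t) (simp add: algebra_simps)

text \<open>If \<open>w\<close> is in the kernel of the Hessian matrix at \<open>p\<close>, then the second derivative at \<open>p\<close> in the direction of \<open>w\<close>
vanishes, and by Euler's relation so does the first. By the same relation \<open>w\<close> is not a multiple of \<open>p\<close>:
otherwise \<open>p\<close> would be singular.\<close>

lemma has_flex_if_hessian_kernel:
  assumes p: "p \<noteq> (0, 0, 0)" "cubic_eval f p = 0" and w: "w \<noteq> (0, 0, 0)" "\<And>v. polar3 f p w v = 0"
    and nonsing: "cubic_S f ^ 3 \<noteq> cubic_T f ^ 2"
  shows "has_flex f"
proof -
  obtain u where u: "polar f p u \<noteq> 0" using singular_imp_invariants[OF p(1)] nonsing by blast
  have pp: "polar f p p = 0" using p(2) by (simp add: polar_self)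
  have pw: "polar f p w = 0" using w(2)[of p] polar3_self[of f p w] polar3_commute(2)[of f p w p] by simp
  have wp: "polar f w p = 0" using w(2)[of w] polar3_self[of f w p] polar3_commute(1)[of f p w w] polar3_commute(2)[of f w p w] by simp
  have "det3 w p u \<noteq> 0"
  proof
    assume "det3 w p u = 0"
    then obtain v where v: "v \<noteq> (0, 0, 0)" "lincomb w p u v = (0, 0, 0)" by (rule det3_zero_imp_kernel)
    obtain a b c where abc: "v = (a, b, c)" by (metis prod.exhaust)
    have "polar f p (lincomb w p u v) = 0" unfolding v(2) by (cases p) simp
    then have c: "c = 0" using u pp pw by (simp add: abc polar_lincomb)
    have "polar3 f p u (lincomb w p u v) = 0" unfolding v(2) by (cases p; cases u) simp
    then have "b * polar3 f p u p = 0"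
      using c w(2)[of u] polar3_commute(2)[of f p u w] by (simp add: abc polar3_lincomb)
    then have b: "b = 0" using u polar3_self[of f p u] polar3_commute(2)[of f p u p] by simp
    have "a = 0" using v(2) w(1) b c by (cases w; cases p; cases u) (auto simp: abc)
    with v(1) b c show False by (simp add: abc)
  qed
  with p pw wp show ?thesis unfolding has_flex_def by blast
qed

lemma has_flex_nagell:
  assumes "cubic_S (nagell_coeffs c0 c1 c2) ^ 3 \<noteq> cubic_T (nagell_coeffs c0 c1 c2) ^ 2"
  shows "has_flex (nagell_coeffs c0 c1 c2)"
proof -
  obtain x y z where p: "(x, y, z) \<noteq> (0, 0, 0)"
    "y * x^2 + z^2 * x + c0 * y^3 + c1 * y^2 * z + c2 * y * z^2 = 0"
    "y * ((3 * c0 * y + c1 * z) * (x + c2 * y) - (c1 * y + c2 * z)^2)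
        - x * (x * (x + c2 * y) - z * (c1 * y + c2 * z)) + z * (x * (c1 * y + c2 * z) - z * (3 * c0 * y + c1 * z)) = 0"
    using nagell_flex_point[of c0 c1 c2] by (elim exE conjE)
  define r1 r2 r3 where r: "r1 = (y, x, z)" "r2 = (x, 3 * c0 * y + c1 * z, c1 * y + c2 * z)" "r3 = (z, c1 * y + c2 * z, x + c2 * y)"
  have "det3 r1 r2 r3 = 0" using p(3) unfolding r det3.simps by algebra
  then obtain w where w: "w \<noteq> (0, 0, 0)" "lincomb r1 r2 r3 w = (0, 0, 0)" by (rule det3_zero_imp_kernel)
  show ?thesis
  proof (rule has_flex_if_hessian_kernel[OF p(1) _ w(1) _ assms])
    show "cubic_eval (nagell_coeffs c0 c1 c2) (x, y, z) = 0"
      using p(2) by (simp add: nagell_coeffs_def cubic_value_def algebra_simps)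
    fix v :: vec3
    obtain a b c d e g where wv: "w = (a, b, c)" "v = (d, e, g)" by (metis prod.exhaust)
    from w(2) have k: "y * a + x * b + z * c = 0" "x * a + (3 * c0 * y + c1 * z) * b + (c1 * y + c2 * z) * c = 0"
       "z * a + (c1 * y + c2 * z) * b + (x + c2 * y) * c = 0"
      by (simp_all add: r wv)
    have "polar3 (nagell_coeffs c0 c1 c2) (x, y, z) w v = 2 * (d * (y * a + x * b + z * c)
        + e * (x * a + (3 * c0 * y + c1 * z) * b + (c1 * y + c2 * z) * c)
        + g * (z * a + (c1 * y + c2 * z) * b + (x + c2 * y) * c))"
      unfolding wv nagell_coeffs_def polar3.simps nth10 by algebra
    then show "polar3 (nagell_coeffs c0 c1 c2) (x, y, z) w v = 0" unfolding k by simp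
  qed
qed

section \<open>Weierstrass form of a cubic through a coordinate point\<close>

text \<open>Coordinates are adapted to the point \<open>(1:0:0)\<close> of the cubic until \<open>nagell_coeffs\<close> is reached, unless
the point is a flex already.\<close>

lemma weierstrass_if_zero_at_x:
  assumes f0: "f 0 = 0" and nonsing: "cubic_S f ^ 3 \<noteq> cubic_T f ^ 2"
  shows "\<exists>A B. equivalent f (weierstrass_coeffs A B)"
proof -
  have "f 3 \<noteq> 0 \<or> f 4 \<noteq> 0"
  proof (rule ccontr)
    assume "\<not> ?thesis"
    then have "polar f (1, 0, 0) q = 0" for q using f0 by (cases q) simp
    with singular_imp_invariants[of "(1, 0, 0)" f] nonsing show False by simp
  qed
  then obtain s t where st: "f 3 * s + f 4 * t = 1"
  proof
    assume "f 3 \<noteq> 0" then show ?thesis using that[of "1 / f 3" 0] by simp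
  next
    assume "f 4 \<noteq> 0" then show ?thesis using that[of 0 "1 / f 4"] by simp
  qed
  \<comment> \<open>The tangent at (1:0:0) becomes y = 0.\<close>
  define g where "g = pullback f (1, 0, 0) (0, s, t) (0, - f 4, f 3)"
  have fg: "equivalent f g"
    by (rule equivalent_pullback[of "(1, 0, 0)" "(0, s, t)" "(0, - f 4, f 3)" 1])
       (use st in \<open>simp_all add: g_def algebra_simps\<close>)
  have g: "g 0 = 0" "g 3 = 1" "g 4 = 0"
    using f0 st by (simp_all add: g_def pullback_def cubic_value_def)
  \<comment> \<open>A shift of x uses y x^2 to absorb the terms in x y^2 and x y z.\<close>
  define h where "h = pullback g (1, 0, 0) (- g 5 / 2, 1, 0) (- g 9 / 2, 0, 1)"
  have gh: "equivalent g h"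
    by (rule equivalent_pullback[of "(1, 0, 0)" "(- g 5 / 2, 1, 0)" "(- g 9 / 2, 0, 1)" 1]) (simp_all add: h_def)
  have h: "h 0 = 0" "h 3 = 1" "h 4 = 0" "h 5 = 0" "h 9 = 0"
    using g by (simp_all add: h_def pullback_def cubic_value_def)
  have fh: "equivalent f h" using fg gh by (rule equivalent_trans)
  have nonsing_h: "cubic_S h ^ 3 \<noteq> cubic_T h ^ 2"
    using equivalent_nonsingular[OF fh nonsing] .
  show ?thesis
  proof (cases "h 7 = 0")
    case True
    \<comment> \<open>On the tangent y = 0 the cubic is a multiple of z^3.\<close>
    have "has_flex h"
      unfolding has_flex_def
      by (rule exI[of _ "(1, 0, 0)"], rule exI[of _ "(0, 0, 1)"], rule exI[of _ "(0, 1, 0)"])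
         (use h True in \<open>simp add: cubic_value_def\<close>)
    from weierstrass_if_flex[OF this nonsing_h] show ?thesis using fh equivalent_trans by blast
  next
    case False
    define b where "b = h 7"
    define d where "d = h 2 / b"
    have b: "b \<noteq> 0" and h2: "h 2 = b * d" and h7: "h 7 = b" using False by (simp_all add: b_def d_def)
    \<comment> \<open>Replacing x by x - d z cancels the term in z^3. The other entries undo what this does to the terms
        in x y z and x y^2, and the scaling of y by b gives x^2 y and x z^2 the same coefficient b.\<close>
    let ?p = "(1, 0, 0)" and ?q = "(- (d^2) / 2, b, d)" and ?r = "(- d, 0, 1)"
    define c0 c1 c2 where c: "c0 = pullback h ?p ?q ?r 1 / b" "c1 = pullback h ?p ?q ?r 6 / b" "c2 = pullback h ?p ?q ?r 8 / b"
    have "equivalent h (nagell_coeffs c0 c1 c2)"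
    proof (rule equivalent_pullback[of ?p ?q ?r b])
      show "\<forall>i<10. pullback h ?p ?q ?r i = b * nagell_coeffs c0 c1 c2 i"
        unfolding all_less_10 using b
        by (simp add: c nagell_coeffs_def) (use h h2 h7 in \<open>simp add: pullback_def cubic_value_def algebra_simps power2_eq_square power3_eq_cube\<close>)
    qed (use b in simp_all)
    then have fn: "equivalent f (nagell_coeffs c0 c1 c2)" using fh equivalent_trans by blast
    from equivalent_nonsingular[OF this nonsing]
    have non: "cubic_S (nagell_coeffs c0 c1 c2) ^ 3 \<noteq> cubic_T (nagell_coeffs c0 c1 c2) ^ 2" .
    from weierstrass_if_flex[OF has_flex_nagell[OF non] non] fn show ?thesis using equivalent_trans by blast
  qed
qed

section \<open>Binary quartics\<close>

text \<open>The expression is the discriminant of the cubic. If \<open>a\<close> is not zero, it splits off the square of the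
derivative at a root \<open>r\<close>, and the cofactor is the discriminant of the quadratic that remains after
division by the factor of \<open>r\<close>.\<close>

lemma cubic_double_root:
  fixes a b c d :: complex
  assumes disc: "b^2 * c^2 - 4 * a * c^3 - 4 * b^3 * d - 27 * a^2 * d^2 + 18 * a * b * c * d = 0"
    and nz: "a \<noteq> 0 \<or> b \<noteq> 0"
  shows "\<exists>u. a * u^3 + b * u^2 + c * u + d = 0 \<and> 3 * a * u^2 + 2 * b * u + c = 0"
proof (cases "a = 0")
  case True
  with nz have b: "b \<noteq> 0" by simp
  have "b^2 * (c^2 - 4 * b * d) = 0" using disc True by (simp add: algebra_simps power2_eq_square power3_eq_cube)
  with b have "c^2 = 4 * b * d" by simp
  define u where "u = - c / (2 * b)"
  have u: "2 * b * u = - c" using b by (simp add: u_def)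
  have "4 * b * (b * u^2 + c * u + d) = (2 * b * u)^2 + 2 * c * (2 * b * u) + 4 * b * d" by algebra
  also have "\<dots> = 0" unfolding u using \<open>c^2 = 4 * b * d\<close> by algebra
  finally have "b * u^2 + c * u + d = 0" using b by simp
  with u True show ?thesis by (intro exI[of _ u]) simp
next
  case a: False
  have "degree [:d, c, b, a:] > 0" using a by simp
  from alg_closed_imp_poly_has_root[OF this] obtain r where "poly [:d, c, b, a:] r = 0" by (rule exE)
  then have d: "d = - (a * r^3 + b * r^2 + c * r)" by (simp add: algebra_simps power2_eq_square power3_eq_cube eq_neg_iff_add_eq_0)
  let ?m = "3 * a * r^2 + 2 * b * r + c" and ?b = "b + a * r" and ?c = "c + b * r + a * r^2"
  have "?m^2 * (?b^2 - 4 * a * ?c) = 0" using disc unfolding d by algebra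
  then consider "?m = 0" | "?b^2 = 4 * a * ?c" by auto
  then show ?thesis
  proof cases
    case 1
    have "a * r^3 + b * r^2 + c * r + d = 0" unfolding d by simp
    with 1 show ?thesis by blast
  next
    case 2
    define u where "u = - ?b / (2 * a)"
    have u: "2 * a * u + ?b = 0" using a by (simp add: u_def)
    have "4 * a * (a * u^2 + ?b * u + ?c) = (2 * a * u + ?b)^2 - (?b^2 - 4 * a * ?c)" by algebra
    then have quad: "a * u^2 + ?b * u + ?c = 0" using u 2 a by simp
    have "a * u^3 + b * u^2 + c * u + d = (u - r) * (a * u^2 + ?b * u + ?c)" unfolding d by algebra
    moreover have "3 * a * u^2 + 2 * b * u + c = (a * u^2 + ?b * u + ?c) + (u - r) * (2 * a * u + ?b)" by algebra
    ultimately show ?thesis using quad u by (intro exI[of _ u]) simp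
  qed
qed

text \<open>Hypothesis and conclusion are invariant under translations, so that a root of the quartic can be moved
to 0. The discriminant then splits into the square of the linear coefficient and the discriminant
of a cubic. The repeated root is a point of the projective line, hence the two partial derivatives.\<close>

lemma quartic_repeated_root:
  fixes a b c d e :: complex
  assumes disc: "4 * (12 * a * e - 3 * b * d + c^2) ^ 3 = (72 * a * c * e + 9 * b * c * d - 27 * a * d^2 - 27 * e * b^2 - 2 * c^3) ^ 2"
  shows "\<exists>y z. (y, z) \<noteq> (0, 0) \<and> 4 * a * y^3 + 3 * b * y^2 * z + 2 * c * y * z^2 + d * z^3 = 0
     \<and> b * y^3 + 2 * c * y^2 * z + 3 * d * y * z^2 + 4 * e * z^3 = 0"
proof (cases "a = 0 \<and> b = 0")
  case True
  then show ?thesis by (intro exI[of _ 1] exI[of _ 0]) simp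
next
  case False
  then have "degree [:e, d, c, b, a:] > 0" by auto
  from alg_closed_imp_poly_has_root[OF this] obtain t where "poly [:e, d, c, b, a:] t = 0" by (rule exE)
  then have e: "e = - (a * t^4 + b * t^3 + c * t^2 + d * t)"
    by (simp add: algebra_simps power2_eq_square power3_eq_cube power4_eq_xxxx eq_neg_iff_add_eq_0)
  \<comment> \<open>The coefficients of the quartic translated by the root t; its constant coefficient is 0.\<close>
  define b' c' d' where s: "b' = b + 4 * a * t" "c' = c + 3 * b * t + 6 * a * t^2"
    "d' = d + 2 * c * t + 3 * b * t^2 + 4 * a * t^3"
  have "27 * (d'^2 * (b'^2 * c'^2 - 4 * a * c'^3 - 4 * b'^3 * d' - 27 * a^2 * d'^2 + 18 * a * b' * c' * d')) =
     4 * (12 * a * e - 3 * b * d + c^2) ^ 3 - (72 * a * c * e + 9 * b * c * d - 27 * a * d^2 - 27 * e * b^2 - 2 * c^3) ^ 2"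
    unfolding s e by algebra
  then consider "d' = 0"
    | "b'^2 * c'^2 - 4 * a * c'^3 - 4 * b'^3 * d' - 27 * a^2 * d'^2 + 18 * a * b' * c' * d' = 0"
    using disc by auto
  then obtain u where u: "4 * a * (t + u)^3 + 3 * b * (t + u)^2 + 2 * c * (t + u) + d = 0"
    "b * (t + u)^3 + 2 * c * (t + u)^2 + 3 * d * (t + u) + 4 * e = 0"
  proof cases
    case 1
    have "4 * a * t^3 + 3 * b * t^2 + 2 * c * t + d = d'" unfolding s by algebra
    moreover have "b * t^3 + 2 * c * t^2 + 3 * d * t + 4 * e = - t * d'" unfolding s e by algebra
    ultimately show ?thesis using that[of 0] 1 by simp
  next
    case 2
    have "a \<noteq> 0 \<or> b' \<noteq> 0" using False by (auto simp: s)
    from cubic_double_root[OF 2 this] obtain u where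
      u: "a * u^3 + b' * u^2 + c' * u + d' = 0" "3 * a * u^2 + 2 * b' * u + c' = 0" by blast
    have "4 * a * (t + u)^3 + 3 * b * (t + u)^2 + 2 * c * (t + u) + d
        = (a * u^3 + b' * u^2 + c' * u + d') + u * (3 * a * u^2 + 2 * b' * u + c')"
      unfolding s by algebra
    moreover have "b * (t + u)^3 + 2 * c * (t + u)^2 + 3 * d * (t + u) + 4 * e
        = 4 * u * (a * u^3 + b' * u^2 + c' * u + d')
          - (t + u) * ((a * u^3 + b' * u^2 + c' * u + d') + u * (3 * a * u^2 + 2 * b' * u + c'))"
      unfolding s e by algebra
    ultimately show ?thesis using that[of u] u by simp
  qed
  then show ?thesis by (intro exI[of _ "t + u"] exI[of _ 1]) simp
qed

section \<open>Cubics through the three coordinate points\<close>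

definition coeff_vector :: "(cubic_coeff \<Rightarrow> complex) \<Rightarrow> nat \<Rightarrow> complex" where
  "coeff_vector c = (!) [0, 0, 0, c C1, c C2, c C3, c C5, c C4, c C6, c C7]"

lemma cubic_S_coeff_vector: "cubic_S (coeff_vector c) = c4_form c"
  unfolding cubic_S_def coeff_vector_def nth10 form_defs drop_zeros by algebra

lemma discriminant_eq_S_T:
  "1728 * discriminant_form c = cubic_S (coeff_vector c) ^ 3 - cubic_T (coeff_vector c) ^ 2"
  unfolding cubic_S_def cubic_T_def coeff_vector_def nth10 form_defs drop_zeros by algebra

text \<open>The numbers \<open>a\<close> to \<open>e\<close> are the coefficients of \<open>B\<^sup>2 - 4 A C\<close>, and the right-hand side is 27 times the
discriminant of this quartic.\<close>

lemma discriminant_eq_quartic: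
  fixes k :: "cubic_coeff \<Rightarrow> complex"
  defines "a \<equiv> k C3 ^ 2" and "b \<equiv> 2 * k C3 * k C7 - 4 * k C1 * k C5"
    and "c \<equiv> k C7 ^ 2 + 2 * k C3 * k C4 - 4 * (k C1 * k C6 + k C2 * k C5)"
    and "d \<equiv> 2 * k C4 * k C7 - 4 * k C2 * k C6" and "e \<equiv> k C4 ^ 2"
  shows "6912 * discriminant_form k = 4 * (12 * a * e - 3 * b * d + c^2) ^ 3
    - (72 * a * c * e + 9 * b * c * d - 27 * a * d^2 - 27 * e * b^2 - 2 * c^3) ^ 2"
  unfolding a_def b_def c_def d_def e_def form_defs by algebra

text \<open>If \<open>A\<close> is zero identically, \<open>(1:0:0)\<close> is singular. Otherwise let \<open>(y:z)\<close> be a repeated root of \<open>B\<^sup>2 - 4 A C\<close>.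
If \<open>A\<close> does not vanish there, the unique point of the cubic above it is \<open>x = - B / (2 A)\<close>, and it is
singular. If \<open>A\<close> vanishes there, so do \<open>B\<close> and \<open>C\<close>, hence the cubic contains the line above \<open>(y:z)\<close>. On this
line the derivative with respect to one of \<open>y\<close> and \<open>z\<close> is quadratic in \<open>x\<close>; at a root of it, Euler's
relation makes the other derivative vanish, too.\<close>

lemma singular_if_discriminant_zero:
  assumes "discriminant_form k = 0"
  shows "\<exists>p. p \<noteq> (0, 0, 0) \<and> (\<forall>q. polar (coeff_vector k) p q = 0)"
proof -
  define Fx where "Fx = (\<lambda>x y z. 2 * x * (k C1 * y + k C2 * z) + (k C3 * y^2 + k C7 * y * z + k C4 * z^2))"
  define Fy where "Fy = (\<lambda>x y z. k C1 * x^2 + x * (2 * k C3 * y + k C7 * z) + (2 * k C5 * y * z + k C6 * z^2))"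
  define Fz where "Fz = (\<lambda>x y z. k C2 * x^2 + x * (k C7 * y + 2 * k C4 * z) + (k C5 * y^2 + 2 * k C6 * y * z))"
  have polar: "polar (coeff_vector k) (x, y, z) (u, v, w) = Fx x y z * u + Fy x y z * v + Fz x y z * w" for x y z u v w
    unfolding Fx_def Fy_def Fz_def polar.simps coeff_vector_def nth10 by (simp add: algebra_simps)
  have "\<exists>x y z. (x, y, z) \<noteq> (0, 0, 0) \<and> Fx x y z = 0 \<and> Fy x y z = 0 \<and> Fz x y z = 0"
  proof (cases "k C1 = 0 \<and> k C2 = 0")
    case True
    then show ?thesis
      by (intro exI[of _ 1] exI[of _ 0]) (simp add: Fx_def Fy_def Fz_def)
  next
    case k12: False
    have zero_diff: "v = w" if "6912 * 0 = v - w" for v w :: complex using that by simp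
    from quartic_repeated_root[OF zero_diff[OF discriminant_eq_quartic[of k, unfolded assms]]]
    obtain y z where yz: "(y, z) \<noteq> (0, 0)" and
      qy: "4 * (k C3 ^ 2) * y^3 + 3 * (2 * k C3 * k C7 - 4 * k C1 * k C5) * y^2 * z
        + 2 * (k C7 ^ 2 + 2 * k C3 * k C4 - 4 * (k C1 * k C6 + k C2 * k C5)) * y * z^2
        + (2 * k C4 * k C7 - 4 * k C2 * k C6) * z^3 = 0" and
      qz: "(2 * k C3 * k C7 - 4 * k C1 * k C5) * y^3
        + 2 * (k C7 ^ 2 + 2 * k C3 * k C4 - 4 * (k C1 * k C6 + k C2 * k C5)) * y^2 * z
        + 3 * (2 * k C4 * k C7 - 4 * k C2 * k C6) * y * z^2 + 4 * (k C4 ^ 2) * z^3 = 0"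
      by (elim exE conjE)
    define A B C where ABC: "A = k C1 * y + k C2 * z" "B = k C3 * y^2 + k C7 * y * z + k C4 * z^2"
      "C = k C5 * y^2 * z + k C6 * y * z^2"
    define By Bz Cy Cz where d: "By = 2 * k C3 * y + k C7 * z" "Bz = k C7 * y + 2 * k C4 * z"
      "Cy = 2 * k C5 * y * z + k C6 * z^2" "Cz = k C5 * y^2 + 2 * k C6 * y * z"
    have "2 * B * By - 4 * (k C1 * C + A * Cy) =
        4 * (k C3 ^ 2) * y^3 + 3 * (2 * k C3 * k C7 - 4 * k C1 * k C5) * y^2 * z
        + 2 * (k C7 ^ 2 + 2 * k C3 * k C4 - 4 * (k C1 * k C6 + k C2 * k C5)) * y * z^2
        + (2 * k C4 * k C7 - 4 * k C2 * k C6) * z^3"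
      unfolding ABC d by algebra
    with qy have qy': "2 * B * By - 4 * (k C1 * C + A * Cy) = 0" by (simp only:)
    have "2 * B * Bz - 4 * (k C2 * C + A * Cz) = (2 * k C3 * k C7 - 4 * k C1 * k C5) * y^3
        + 2 * (k C7 ^ 2 + 2 * k C3 * k C4 - 4 * (k C1 * k C6 + k C2 * k C5)) * y^2 * z
        + 3 * (2 * k C4 * k C7 - 4 * k C2 * k C6) * y * z^2 + 4 * (k C4 ^ 2) * z^3"
      unfolding ABC d by algebra
    with qz have qz': "2 * B * Bz - 4 * (k C2 * C + A * Cz) = 0" by (simp only:)
    have "4 * (B^2 - 4 * A * C) = y * (2 * B * By - 4 * (k C1 * C + A * Cy)) + z * (2 * B * Bz - 4 * (k C2 * C + A * Cz))"
      unfolding ABC d by algebra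
    then have q: "B^2 - 4 * A * C = 0" unfolding qy' qz' by simp
    have F: "Fx x y z = 2 * x * A + B" "Fy x y z = k C1 * x^2 + x * By + Cy" "Fz x y z = k C2 * x^2 + x * Bz + Cz" for x
      by (simp_all add: Fx_def Fy_def Fz_def ABC d)
    show ?thesis
    proof (cases "A = 0")
      case False
      define x where "x = - B / (2 * A)"
      have x: "B = - (2 * A * x)" using False by (simp add: x_def)
      have "Fx x y z = 0" unfolding F x by simp
      moreover have "4 * A * (k C1 * x^2 + x * By + Cy) = k C1 * 4 * A * x^2 - 2 * B * By + 4 * A * Cy" unfolding x by algebra
      moreover have "A * (k C1 * 4 * A * x^2 - 2 * B * By + 4 * A * Cy) = k C1 * (B^2 - 4 * A * C) - A * (2 * B * By - 4 * (k C1 * C + A * Cy))" unfolding x by algebra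
      moreover have "4 * A * (k C2 * x^2 + x * Bz + Cz) = k C2 * 4 * A * x^2 - 2 * B * Bz + 4 * A * Cz" unfolding x by algebra
      moreover have "A * (k C2 * 4 * A * x^2 - 2 * B * Bz + 4 * A * Cz) = k C2 * (B^2 - 4 * A * C) - A * (2 * B * Bz - 4 * (k C2 * C + A * Cz))" unfolding x by algebra
      ultimately have "Fx x y z = 0" "Fy x y z = 0" "Fz x y z = 0"
        using False unfolding q qy' qz' F by simp_all
      with yz show ?thesis by (intro exI[of _ x] exI[of _ y] exI[of _ z]) auto
    next
      case A: True
      then have B: "B = 0" using q by simp
      have C: "C = 0" using qy' qz' A B k12 by auto
      have euler: "y * Fy x y z + z * Fz x y z = 0" for x
      proof -
        have "y * Fy x y z + z * Fz x y z = A * x^2 + 2 * B * x + 3 * C" unfolding F ABC d by algebra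
        then show ?thesis by (simp add: A B C)
      qed
      have Fx: "Fx x y z = 0" for x unfolding F by (simp add: A B)
      show ?thesis
      proof (cases "k C1 = 0")
        case False
        then have "degree [:Cy, By, k C1:] > 0" by simp
        from alg_closed_imp_poly_has_root[OF this] obtain x where "poly [:Cy, By, k C1:] x = 0" by (rule exE)
        then have x: "Fy x y z = 0" unfolding F by (simp add: algebra_simps power2_eq_square)
        have "z \<noteq> 0" using A False yz by (auto simp: ABC)
        then have "Fz x y z = 0" using euler[of x] x by simp
        with x Fx yz show ?thesis by (intro exI[of _ x] exI[of _ y] exI[of _ z]) auto
      next
        case True
        with k12 have k2: "k C2 \<noteq> 0" by simp
        then have "degree [:Cz, Bz, k C2:] > 0" by simp
        from alg_closed_imp_poly_has_root[OF this] obtain x where "poly [:Cz, Bz, k C2:] x = 0" by (rule exE)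
        then have x: "Fz x y z = 0" unfolding F by (simp add: algebra_simps power2_eq_square)
        have "y \<noteq> 0" using A True k2 yz by (auto simp: ABC)
        then have "Fy x y z = 0" using euler[of x] x by simp
        with x Fx yz show ?thesis by (intro exI[of _ x] exI[of _ y] exI[of _ z]) auto
      qed
    qed
  qed
  then obtain x y z where "(x, y, z) \<noteq> (0, 0, 0)" "Fx x y z = 0" "Fy x y z = 0" "Fz x y z = 0" by blast
  then have "(x, y, z) \<noteq> (0, 0, 0) \<and> (\<forall>q. polar (coeff_vector k) (x, y, z) q = 0)"
    using polar[of x y z] by (auto simp: split_paired_all)
  then show ?thesis by blast
qed

section \<open>Singular points and partial derivatives\<close>

lemma partial_deriv_superset:
  assumes "finite A" "Poly_Mapping.keys p \<subseteq> A"
  shows "partial_deriv v p = (\<Sum>m\<in>A. Poly_Mapping.single (m - Poly_Mapping.single v 1)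
      (of_nat (Poly_Mapping.lookup m v) * Poly_Mapping.lookup p m))"
  unfolding partial_deriv_def
  by (rule sum.mono_neutral_left) (use assms in \<open>auto simp: in_keys_iff\<close>)

lemma partial_deriv_0 [simp]: "partial_deriv v 0 = 0"
  by (simp add: partial_deriv_def)

lemma partial_deriv_single:
  "partial_deriv v (Poly_Mapping.single m c) =
     Poly_Mapping.single (m - Poly_Mapping.single v 1) (of_nat (Poly_Mapping.lookup m v) * c)"
  by (subst partial_deriv_superset[of "{m}"]) auto

lemma partial_deriv_add: "partial_deriv v (p + q) = partial_deriv v p + partial_deriv v q"
proof -
  let ?A = "Poly_Mapping.keys p \<union> Poly_Mapping.keys q"
  have "partial_deriv v (p + q) = (\<Sum>m\<in>?A. Poly_Mapping.single (m - Poly_Mapping.single v 1)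
      (of_nat (Poly_Mapping.lookup m v) * Poly_Mapping.lookup (p + q) m))"
    by (rule partial_deriv_superset) (use Poly_Mapping.keys_add[of p q] in auto)
  also have "\<dots> = partial_deriv v p + partial_deriv v q"
    by (simp add: partial_deriv_superset[of ?A] lookup_add distrib_left single_add sum.distrib)
  finally show ?thesis .
qed

lemma partial_deriv_mult_single:
  fixes c d :: "'a::comm_ring_1"
  shows "partial_deriv v (Poly_Mapping.single m c * Poly_Mapping.single n d) =
    partial_deriv v (Poly_Mapping.single m c) * Poly_Mapping.single n d
    + Poly_Mapping.single m c * partial_deriv v (Poly_Mapping.single n d)"
proof -
  let ?e = "Poly_Mapping.single v (1::nat)"
  have shift: "k - ?e + l = k + l - ?e" if "Poly_Mapping.lookup k v \<noteq> 0" for k l :: "'b \<Rightarrow>\<^sub>0 nat"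
    using that by (intro poly_mapping_eqI) (auto simp: lookup_add lookup_minus lookup_single when_def)
  have move: "Poly_Mapping.single (k - ?e + l) (of_nat (Poly_Mapping.lookup k v) * a)
      = Poly_Mapping.single (k + l - ?e) (of_nat (Poly_Mapping.lookup k v) * a)" for k l and a :: 'a
    using shift[of k l] by (cases "Poly_Mapping.lookup k v = 0") simp_all
  have "Poly_Mapping.single (m + n - ?e) (of_nat (Poly_Mapping.lookup (m + n) v) * (c * d))
      = Poly_Mapping.single (m + n - ?e) (of_nat (Poly_Mapping.lookup m v) * (c * d))
        + Poly_Mapping.single (n + m - ?e) (of_nat (Poly_Mapping.lookup n v) * (c * d))"
    by (simp add: lookup_add ring_distribs single_add add.commute)
  then show ?thesis
    unfolding move[symmetric]
    by (simp add: partial_deriv_single mult_single mult_ac add.commute)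
qed

text \<open>Needed because the cubic is given as an expression in the indeterminates, not by its terms.\<close>

lemma partial_deriv_mult:
  fixes p q :: "('v, 'a::comm_ring_1) mpol"
  shows "partial_deriv v (p * q) = partial_deriv v p * q + p * partial_deriv v q"
proof (induction p rule: poly_mapping_single_add_induct)
  case (single_add k c p)
  have "partial_deriv v (Poly_Mapping.single k c * q) =
      partial_deriv v (Poly_Mapping.single k c) * q + Poly_Mapping.single k c * partial_deriv v q"
  proof (induction q rule: poly_mapping_single_add_induct)
    case (single_add l d q)
    then show ?case
      by (simp add: ring_distribs partial_deriv_add partial_deriv_mult_single)
  qed simp
  with single_add show ?case by (simp add: ring_distribs partial_deriv_add)
qed simp

lemma partial_deriv_Const [simp]: "partial_deriv v (Const c) = 0"
  by (simp add: Const_def partial_deriv_single)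

lemma partial_deriv_Var: "partial_deriv v (Var w) = Const (if v = w then 1 else 0)"
  by (auto simp: Var_def Const_def partial_deriv_single lookup_single when_def)

lemma peval_cubic_of_coeffs:
  "peval id (($) P) (cubic_of_coeffs c) = cubic_eval (coeff_vector c) (triple P)"
  by (simp add: cubic_of_coeffs_def Let_def id_hom.peval_ring triple_def cubic_value_def coeff_vector_def algebra_simps)

lemma peval_partial_deriv_cubic_of_coeffs:
  "peval id (($) P) (partial_deriv 1 (cubic_of_coeffs c)) = polar (coeff_vector c) (triple P) (1, 0, 0)"
  "peval id (($) P) (partial_deriv 2 (cubic_of_coeffs c)) = polar (coeff_vector c) (triple P) (0, 1, 0)"
  "peval id (($) P) (partial_deriv 3 (cubic_of_coeffs c)) = polar (coeff_vector c) (triple P) (0, 0, 1)"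
  by (simp_all add: cubic_of_coeffs_def Let_def partial_deriv_add partial_deriv_mult partial_deriv_Var
      id_hom.peval_ring triple_def coeff_vector_def power2_eq_square algebra_simps)

lemma polar_basis:
  "polar f p (a, b, c) = a * polar f p (1, 0, 0) + b * polar f p (0, 1, 0) + c * polar f p (0, 0, 1)"
  by (cases p) (simp add: algebra_simps)

lemma singular_curve_iff:
  "singular_curve (cubic_of_coeffs c) \<longleftrightarrow> (\<exists>p. p \<noteq> (0, 0, 0) \<and> (\<forall>q. polar (coeff_vector c) p q = 0))"
  (is "?L \<longleftrightarrow> ?R")
proof
  assume ?L
  then obtain P :: "complex^3" where P: "P \<noteq> 0" "\<And>i. peval id (($) P) (partial_deriv i (cubic_of_coeffs c)) = 0"
    by (auto simp: singular_curve_def)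
  have "polar (coeff_vector c) (triple P) q = 0" for q
  proof -
    obtain x y z where q: "q = (x, y, z)" by (metis prod.exhaust)
    have "polar (coeff_vector c) (triple P) (1, 0, 0) = 0" "polar (coeff_vector c) (triple P) (0, 1, 0) = 0"
      "polar (coeff_vector c) (triple P) (0, 0, 1) = 0"
      by (simp_all add: P(2) flip: peval_partial_deriv_cubic_of_coeffs)
    then show ?thesis unfolding q polar_basis[of _ _ x y z] by simp
  qed
  with P(1) show ?R using triple_eq_0_iff by blast
next
  assume ?R
  then obtain p where p: "p \<noteq> (0, 0, 0)" "\<And>q. polar (coeff_vector c) p q = 0" by blast
  obtain P where P: "p = triple P" using triple_surj by blast
  have "cubic_eval (coeff_vector c) p = 0" using polar_self[of "coeff_vector c" p] p(2) by simp
  with p show ?L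
    unfolding singular_curve_def
    by (intro exI[of _ P]) (simp add: P triple_eq_0_iff forall_3 peval_cubic_of_coeffs peval_partial_deriv_cubic_of_coeffs)
qed

theorem discriminant_zero_iff_singular:
  "discriminant_form c = 0 \<longleftrightarrow> singular_curve (cubic_of_coeffs c)"
proof
  assume "singular_curve (cubic_of_coeffs c)"
  then obtain p where "p \<noteq> (0, 0, 0)" "\<And>q. polar (coeff_vector c) p q = 0"
    unfolding singular_curve_iff by blast
  from singular_imp_invariants[OF this] discriminant_eq_S_T[of c] show "discriminant_form c = 0" by simp
qed (use singular_if_discriminant_zero singular_curve_iff in blast)

section \<open>Projective equivalence and the j-invariant\<close>

lemma peval_linear_subst: "peval id (($) v) (linear_subst M F) = peval id (($) (M *v v)) F"
proof -
  have "peval id (($) v) (\<Sum>j\<in>UNIV. Const (M $ i $ j) * Var j) = (M *v v) $ i" for i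
    by (simp add: id_hom.peval_sum id_hom.peval_mult matrix_vector_mult_def)
  then show ?thesis by (simp add: linear_subst_def id_hom.peval_peval_Const)
qed

lemma mpol3_eq_iff: "p = q \<longleftrightarrow> (\<forall>v. peval id (($) v) p = peval id (($) v) q)" for p q :: "(3, complex) mpol"
proof
  assume eq: "\<forall>v. peval id (($) v) p = peval id (($) v) q"
  show "p = q"
  proof (rule mpol_eq_if_evals_eq)
    fix \<sigma> :: "3 \<Rightarrow> complex"
    have "($) (\<chi> i. \<sigma> i) = \<sigma>" by (simp add: fun_eq_iff)
    with eq show "peval id \<sigma> p = peval id \<sigma> q" by metis
  qed
qed simp

lemma peval_weierstrass: "peval id (($) v) (weierstrass_cubic A B) = cubic_eval (weierstrass_coeffs A B) (triple v)"
  by (simp add: weierstrass_cubic_def id_hom.peval_ring triple_def cubic_value_def weierstrass_coeffs_def algebra_simps)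

lemma projectively_equivalent_weierstrass_iff:
  "projectively_equivalent (cubic_of_coeffs c) (weierstrass_cubic A B) \<longleftrightarrow>
     equivalent (coeff_vector c) (weierstrass_coeffs A B)"
proof -
  have subst_iff: "linear_subst (mat3 p q r) (cubic_of_coeffs c) = Const k * weierstrass_cubic A B \<longleftrightarrow>
     (\<forall>v. cubic_eval (coeff_vector c) (lincomb p q r v) = k * cubic_eval (weierstrass_coeffs A B) v)" for p q r k
  proof -
    have "linear_subst (mat3 p q r) (cubic_of_coeffs c) = Const k * weierstrass_cubic A B \<longleftrightarrow>
      (\<forall>v. cubic_eval (coeff_vector c) (lincomb p q r (triple v)) = k * cubic_eval (weierstrass_coeffs A B) (triple v))"
      by (simp add: mpol3_eq_iff peval_linear_subst peval_cubic_of_coeffs triple_mat3 id_hom.peval_mult peval_weierstrass)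
    also have "\<dots> \<longleftrightarrow> (\<forall>v. cubic_eval (coeff_vector c) (lincomb p q r v) = k * cubic_eval (weierstrass_coeffs A B) v)"
      using triple_surj by metis
    finally show ?thesis .
  qed
  show ?thesis
    unfolding projectively_equivalent_def equivalent_def
    using mat3_surj invertible_det_nz det_mat3 subst_iff by metis
qed

lemma invariants_weierstrass:
  "cubic_S (weierstrass_coeffs A B) = - 48 * A" "cubic_T (weierstrass_coeffs A B) = 864 * B"
  by (simp_all add: cubic_S_def cubic_T_def weierstrass_coeffs_def)

text \<open>An equivalence multiplies \<open>S\<^sup>3\<close> and \<open>T\<^sup>2\<close> by the same nonzero factor.\<close>

lemma j_if_equivalent:
  assumes eq: "equivalent f (weierstrass_coeffs A B)" and nonsing: "cubic_S f ^ 3 \<noteq> cubic_T f ^ 2"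
  shows "4 * A ^ 3 + 27 * B ^ 2 \<noteq> 0"
    and "1728 * (4 * A ^ 3) / (4 * A ^ 3 + 27 * B ^ 2) = 1728 * cubic_S f ^ 3 / (cubic_S f ^ 3 - cubic_T f ^ 2)"
proof -
  obtain d k where dk: "d \<noteq> 0" "k \<noteq> 0" and
    S: "k ^ 4 * (- 48 * A) = d ^ 4 * cubic_S f" and T: "k ^ 6 * (864 * B) = d ^ 6 * cubic_T f"
    using equivalent_imp_invariants[OF eq] unfolding invariants_weierstrass by blast
  have S3: "d ^ 12 * cubic_S f ^ 3 = - 27648 * k ^ 12 * (4 * A ^ 3)"
  proof -
    have "d ^ 12 * cubic_S f ^ 3 = (d ^ 4 * cubic_S f) ^ 3" by algebra
    also have "\<dots> = - 27648 * k ^ 12 * (4 * A ^ 3)" unfolding S[symmetric] by algebra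
    finally show ?thesis .
  qed
  have T2: "d ^ 12 * cubic_T f ^ 2 = 27648 * k ^ 12 * (27 * B ^ 2)"
  proof -
    have "d ^ 12 * cubic_T f ^ 2 = (d ^ 6 * cubic_T f) ^ 2" by algebra
    also have "\<dots> = 27648 * k ^ 12 * (27 * B ^ 2)" unfolding T[symmetric] by algebra
    finally show ?thesis .
  qed
  have diff: "d ^ 12 * (cubic_S f ^ 3 - cubic_T f ^ 2) = - 27648 * k ^ 12 * (4 * A ^ 3 + 27 * B ^ 2)"
    unfolding right_diff_distrib S3 T2 by algebra
  show disc: "4 * A ^ 3 + 27 * B ^ 2 \<noteq> 0"
    using diff dk nonsing by auto
  have "cubic_S f ^ 3 / (cubic_S f ^ 3 - cubic_T f ^ 2)
      = (d ^ 12 * cubic_S f ^ 3) / (d ^ 12 * (cubic_S f ^ 3 - cubic_T f ^ 2))"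
    using dk by simp
  also have "\<dots> = 4 * A ^ 3 / (4 * A ^ 3 + 27 * B ^ 2)"
    unfolding S3 diff by (rule mult_divide_mult_cancel_left) (use dk in simp)
  finally show "1728 * (4 * A ^ 3) / (4 * A ^ 3 + 27 * B ^ 2) = 1728 * cubic_S f ^ 3 / (cubic_S f ^ 3 - cubic_T f ^ 2)"
    by (simp add: times_divide_eq_right[symmetric] del: times_divide_eq_right)
qed

text \<open>A flex exists because the cubic passes through \<open>(1:0:0)\<close>; this gives a Weierstrass form, and
\<open>j_if_equivalent\<close> gives the same value for all of them.\<close>

theorem j_invariant_cubic_of_coeffs:
  assumes "discriminant_form c \<noteq> 0"
  shows "j_invariant (cubic_of_coeffs c) = c4_form c ^ 3 / discriminant_form c"
proof -
  let ?f = "coeff_vector c"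
  have nonsing: "cubic_S ?f ^ 3 \<noteq> cubic_T ?f ^ 2" using assms discriminant_eq_S_T[of c] by auto
  have j: "c4_form c ^ 3 / discriminant_form c = 1728 * cubic_S ?f ^ 3 / (cubic_S ?f ^ 3 - cubic_T ?f ^ 2)"
  proof -
    have "cubic_S ?f ^ 3 - cubic_T ?f ^ 2 = 1728 * discriminant_form c" by (simp add: discriminant_eq_S_T)
    then show ?thesis by (simp only: cubic_S_coeff_vector) simp
  qed
  have "?f 0 = 0" by (simp add: coeff_vector_def)
  from weierstrass_if_zero_at_x[OF this nonsing] obtain A B where AB: "equivalent ?f (weierstrass_coeffs A B)" by blast
  show ?thesis
    unfolding j_invariant_def projectively_equivalent_weierstrass_iff
  proof (rule the_equality)
    show "\<exists>A B. 4 * A ^ 3 + 27 * B ^ 2 \<noteq> 0 \<and> equivalent ?f (weierstrass_coeffs A B) \<and>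
        c4_form c ^ 3 / discriminant_form c = 1728 * (4 * A ^ 3) / (4 * A ^ 3 + 27 * B ^ 2)"
      using AB j_if_equivalent[OF AB nonsing] j by metis
  next
    fix j' assume "\<exists>A B. 4 * A ^ 3 + 27 * B ^ 2 \<noteq> 0 \<and> equivalent ?f (weierstrass_coeffs A B) \<and>
        j' = 1728 * (4 * A ^ 3) / (4 * A ^ 3 + 27 * B ^ 2)"
    then show "j' = c4_form c ^ 3 / discriminant_form c"
      using j_if_equivalent(2)[OF _ nonsing] j by metis
  qed
qed

theorem proposition12:
  shows "\<exists>(D :: (cubic_coeff, int) mpol) (I :: (payoff_var, int) mpol).
    is_cubic_discriminant D \<and>
    irreducible I \<and> total_degree I = 8 \<and> num_terms I = 633 \<and>
    (\<forall>a b :: complex^2^2.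
      peval of_int (spohn_coeff a b) D \<noteq> 0 \<longrightarrow>
      j_invariant (spohn_cubic a b) =
        peval of_int (payoff_entry a b) I ^ 3 / peval of_int (spohn_coeff a b) D)"
proof (intro exI conjI allI impI)
  show "is_cubic_discriminant cubic_discriminant"
    unfolding is_cubic_discriminant_def
  proof (intro conjI allI impI)
    show "irreducible cubic_discriminant" by (rule irreducible_cubic_discriminant)
    show "is_unit k" if "\<forall>m. k dvd Poly_Mapping.lookup cubic_discriminant m" for k
      using primitive_cubic_discriminant that by blast
    show "total_degree cubic_discriminant = 12"
      using homogeneous_cubic_discriminant irreducible_cubic_discriminant by (intro total_degree_homogeneous) auto
    show "num_terms cubic_discriminant = 127"
      using cubic_discriminant_terms num_terms_if_nested_check[OF inj_coeff_index homogeneous_cubic_discriminant, of 16] by auto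
    show "peval of_int c cubic_discriminant = 0 \<longleftrightarrow> singular_curve (cubic_of_coeffs c)" for c
      by (simp only: peval_cubic_discriminant discriminant_zero_iff_singular)
  qed (rule lookup_cubic_discriminant)
  show "irreducible spohn_invariant" by (rule irreducible_spohn_invariant)
  show "total_degree spohn_invariant = 8"
    using homogeneous_spohn_invariant irreducible_spohn_invariant by (intro total_degree_homogeneous) auto
  show "num_terms spohn_invariant = 633"
    using spohn_invariant_terms num_terms_if_nested_check[OF inj_payoff_index homogeneous_spohn_invariant, of 16] by auto
  fix a b :: "complex^2^2"
  assume "peval of_int (spohn_coeff a b) cubic_discriminant \<noteq> 0"
  then show "j_invariant (spohn_cubic a b) =
      peval of_int (payoff_entry a b) spohn_invariant ^ 3 / peval of_int (spohn_coeff a b) cubic_discriminant"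
    unfolding spohn_cubic_def peval_cubic_discriminant peval_spohn_invariant spohn_coeff_eq
    by (rule j_invariant_cubic_of_coeffs)
qed

end
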